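(* Let $\mathcal{S}$ be a triangulated category containing all set-indexed coproducts. If $\mathcal{S}$ is a Brown category with a generating phantom projective class, then any object $X$ of $\mathcal{S}$ has projective dimension at most one (with respect to the phantom projective class).
   Context: An object $W$ is finite if for any set-indexed collection $\{X_\alpha\}$ of objects the natural map $\bigoplus_\alpha\mathcal{S}(W,X_\alpha)\to\mathcal{S}(W,\coprod_\alpha X_\alpha)$ is an isomorphism. $\mathcal{P}$ denotes the class of retracts of coproducts of finite objects. A map $X\to Y$ is phantom if for each finite $W$ and each map $W\to X$ the composite $W\to X\to Y$ is zero; $\mathcal{I}$ denotes the class of phantom maps. A pair $(\mathcal{P},\mathcal{I})$ is a projective class if $\mathcal{I}$ is exactly the class of maps $X\to Y$ such that all composites $P\to X\to Y$ with $P$ in $\mathcal{P}$ vanish, $\mathcal{P}$ is exactly the class of objects $P$ such that all composites $P\to X\to Y$ with $X\to Y$ in $\mathcal{I}$ vanish, and each object $X$ lies in an exact triangle $P\to X\to Y\to\Sigma P$ with $P$ in $\mathcal{P}$ and $X\to Y$ in $\mathcal{I}$. $\mathcal{S}$ has a generating phantom projective class if this pair of retracts of coproducts of finite objects and phantom maps is a projective class and it generates, i.e. for each non-zero $X$ there is $P$ in $\mathcal{P}$ with $\mathcal{S}(P,X)\neq 0$. $\mathcal{S}$ is a Brown category if for any two objects $X,Y$, regarding $\mathcal{S}(-,X)$ and $\mathcal{S}(-,Y)$ as functors from finite objects to abelian groups, any natural transformation $\mathcal{S}(-,X)\to\mathcal{S}(-,Y)$ is induced by a map $X\to Y$. $X$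 has projective dimension at most one if it has a projective resolution $0\to P_1\to P_0\to X\to 0$ with $P_0,P_1$ in $\mathcal{P}$, meaning that the sequence becomes exact after applying $\mathcal{S}(P,-)$ for each $P$ in $\mathcal{P}$. *)

theory Defs
  imports "HOL-Algebra.FiniteProduct" "HOL-Algebra.Product_Groups" "HOL-Algebra.Exact_Sequence"
begin

section \<open>Set-sized index collections\<close>

text \<open>
  HOL has no distinction between sets and proper classes, so the words ``set-indexed'' need a
  parameter: \<open>U\<close> is the collection of index sets (subsets of a type \<open>'i\<close>) that count as sets, as
  opposed to proper classes.  The objects of a category may form a collection that is not in \<open>U\<close>.
  The closure properties below hold for the small subsets of \<open>'i\<close> with respect to any Grothendieck
  universe (when \<open>'i\<close> is infinite); closure under power sets is not required, so that, for
  example, the countable subsets of a type are also covered.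
\<close>

locale small_sets =
  fixes U :: "'i set set"
  assumes small_infinite: "\<exists>I\<in>U. infinite I"
    and small_subset: "I \<in> U \<Longrightarrow> J \<subseteq> I \<Longrightarrow> J \<in> U"
    and small_image: "I \<in> U \<Longrightarrow> (f :: 'i \<Rightarrow> 'i) ` I \<in> U"
    and small_Union: "I \<in> U \<Longrightarrow> (\<And>i. i \<in> I \<Longrightarrow> F i \<in> U) \<Longrightarrow> (\<Union>i\<in>I. F i) \<in> U"


section \<open>Triangulated categories\<close>

text \<open>
  \<open>Hom X Y\<close> is the abelian group of maps \<open>X \<rightarrow> Y\<close>, written multiplicatively as in HOL-Algebra:
  the zero map is \<open>\<one>\<^bsub>Hom X Y\<^esub>\<close>, and addition of maps is \<open>\<otimes>\<^bsub>Hom X Y\<^esub>\<close>.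
  \<open>g \<cdot> f\<close> is the composite ``first \<open>f\<close>, then \<open>g\<close>''.
  \<open>Tri X Y Z f g h\<close> says that \<open>X \<rightarrow> Y \<rightarrow> Z \<rightarrow> \<Sigma>X\<close>, with maps \<open>f\<close>, \<open>g\<close>, \<open>h\<close>, is an exact triangle.
\<close>

record ('o, 'm) tri_cat =
  Ob :: "'o set"
  Hom :: "'o \<Rightarrow> 'o \<Rightarrow> 'm monoid"
  Comp :: "'m \<Rightarrow> 'm \<Rightarrow> 'm" (infixr "\<cdot>\<index>" 70)
  Ident :: "'o \<Rightarrow> 'm"
  Susp :: "'o \<Rightarrow> 'o"
  SuspM :: "'m \<Rightarrow> 'm"
  Tri :: "'o \<Rightarrow> 'o \<Rightarrow> 'o \<Rightarrow> 'm \<Rightarrow> 'm \<Rightarrow> 'm \<Rightarrow> bool"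

definition homs :: "('o, 'm) tri_cat \<Rightarrow> 'o \<Rightarrow> 'o \<Rightarrow> 'm set"
  where "homs S X Y = carrier (Hom S X Y)"

definition zero_map :: "('o, 'm) tri_cat \<Rightarrow> 'o \<Rightarrow> 'o \<Rightarrow> 'm"
  where "zero_map S X Y = \<one>\<^bsub>Hom S X Y\<^esub>"

definition is_iso :: "('o, 'm) tri_cat \<Rightarrow> 'o \<Rightarrow> 'o \<Rightarrow> 'm \<Rightarrow> bool"
  where "is_iso S X Y f \<longleftrightarrow> f \<in> homs S X Y \<and>
    (\<exists>g \<in> homs S Y X. g \<cdot>\<^bsub>S\<^esub> f = Ident S X \<and> f \<cdot>\<^bsub>S\<^esub> g = Ident S Y)"

definition is_zero_object :: "('o, 'm) tri_cat \<Rightarrow> 'o \<Rightarrow> bool"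
  where "is_zero_object S Z \<longleftrightarrow> Z \<in> Ob S \<and>
    (\<forall>X \<in> Ob S. (\<exists>!f. f \<in> homs S Z X) \<and> (\<exists>!f. f \<in> homs S X Z))"

definition is_coproduct ::
  "('o, 'm) tri_cat \<Rightarrow> 'j set \<Rightarrow> ('j \<Rightarrow> 'o) \<Rightarrow> 'o \<Rightarrow> ('j \<Rightarrow> 'm) \<Rightarrow> bool"
  where "is_coproduct S I X C \<iota> \<longleftrightarrow>
    (\<forall>i\<in>I. X i \<in> Ob S) \<and> C \<in> Ob S \<and> (\<forall>i\<in>I. \<iota> i \<in> homs S (X i) C) \<and>
    (\<forall>Y \<in> Ob S. \<forall>f. (\<forall>i\<in>I. f i \<in> homs S (X i) Y) \<longrightarrow>
      (\<exists>!h. h \<in> homs S C Y \<and> (\<forall>i\<in>I. h \<cdot>\<^bsub>S\<^esub> \<iota> i = f i)))"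

definition is_retract :: "('o, 'm) tri_cat \<Rightarrow> 'o \<Rightarrow> 'o \<Rightarrow> bool"
  where "is_retract S R X \<longleftrightarrow> R \<in> Ob S \<and> X \<in> Ob S \<and>
    (\<exists>s \<in> homs S R X. \<exists>r \<in> homs S X R. r \<cdot>\<^bsub>S\<^esub> s = Ident S R)"

text \<open>The existence of finite coproducts is stated as existence of a zero object and of binary
  coproducts.\<close>

locale additive_category =
  fixes S :: "('o, 'm) tri_cat" (structure)
  assumes Ident_in: "X \<in> Ob S \<Longrightarrow> Ident S X \<in> homs S X X"
    and Comp_in: "\<lbrakk>X \<in> Ob S; Y \<in> Ob S; Z \<in> Ob S; f \<in> homs S X Y; g \<in> homs S Y Z\<rbrakk>
      \<Longrightarrow> g \<cdot> f \<in> homs S X Z"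
    and Comp_Ident: "\<lbrakk>X \<in> Ob S; Y \<in> Ob S; f \<in> homs S X Y\<rbrakk> \<Longrightarrow> f \<cdot> Ident S X = f"
    and Ident_Comp: "\<lbrakk>X \<in> Ob S; Y \<in> Ob S; f \<in> homs S X Y\<rbrakk> \<Longrightarrow> Ident S Y \<cdot> f = f"
    and Comp_assoc: "\<lbrakk>W \<in> Ob S; X \<in> Ob S; Y \<in> Ob S; Z \<in> Ob S;
        f \<in> homs S W X; g \<in> homs S X Y; h \<in> homs S Y Z\<rbrakk>
      \<Longrightarrow> (h \<cdot> g) \<cdot> f = h \<cdot> (g \<cdot> f)"
    and comm_group_Hom: "\<lbrakk>X \<in> Ob S; Y \<in> Ob S\<rbrakk> \<Longrightarrow> comm_group (Hom S X Y)"
    and Comp_left_additive: "\<lbrakk>X \<in> Ob S; Y \<in> Ob S; Z \<in> Ob S; g \<in> homs S Y Z\<rbrakk>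
      \<Longrightarrow> (\<lambda>f. g \<cdot> f) \<in> hom (Hom S X Y) (Hom S X Z)"
    and Comp_right_additive: "\<lbrakk>X \<in> Ob S; Y \<in> Ob S; Z \<in> Ob S; f \<in> homs S X Y\<rbrakk>
      \<Longrightarrow> (\<lambda>g. g \<cdot> f) \<in> hom (Hom S Y Z) (Hom S X Z)"
    and zero_object_exists: "\<exists>Z. is_zero_object S Z"
    and binary_coproduct_exists: "\<lbrakk>X \<in> Ob S; Y \<in> Ob S\<rbrakk>
      \<Longrightarrow> \<exists>C \<iota>. is_coproduct S (UNIV :: bool set) (\<lambda>b. if b then X else Y) C \<iota>"

text \<open>
  The suspension is an additive self-equivalence; an automorphism is a special case.
  In the rotation axiom \<open>inv\<^bsub>Hom _ _\<^esub>\<close> is the negative of a map.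
\<close>

locale triangulated_category = additive_category +
  assumes Susp_in: "X \<in> Ob S \<Longrightarrow> Susp S X \<in> Ob S"
    and SuspM_Ident: "X \<in> Ob S \<Longrightarrow> SuspM S (Ident S X) = Ident S (Susp S X)"
    and SuspM_Comp: "\<lbrakk>X \<in> Ob S; Y \<in> Ob S; Z \<in> Ob S; f \<in> homs S X Y; g \<in> homs S Y Z\<rbrakk>
      \<Longrightarrow> SuspM S (g \<cdot> f) = SuspM S g \<cdot> SuspM S f"
    and SuspM_iso: "\<lbrakk>X \<in> Ob S; Y \<in> Ob S\<rbrakk>
      \<Longrightarrow> SuspM S \<in> iso (Hom S X Y) (Hom S (Susp S X) (Susp S Y))"
    and Susp_ess_surj: "Y \<in> Ob S \<Longrightarrow> \<exists>X \<in> Ob S. \<exists>f. is_iso S (Susp S X) Y f"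
    and Tri_maps: "Tri S X Y Z f g h \<Longrightarrow>
      X \<in> Ob S \<and> Y \<in> Ob S \<and> Z \<in> Ob S \<and>
      f \<in> homs S X Y \<and> g \<in> homs S Y Z \<and> h \<in> homs S Z (Susp S X)"
    and Tri_iso: "\<lbrakk>Tri S X Y Z f g h; X' \<in> Ob S; Y' \<in> Ob S; Z' \<in> Ob S;
        f' \<in> homs S X' Y'; g' \<in> homs S Y' Z'; h' \<in> homs S Z' (Susp S X');
        is_iso S X X' a; is_iso S Y Y' b; is_iso S Z Z' c;
        b \<cdot> f = f' \<cdot> a; c \<cdot> g = g' \<cdot> b; SuspM S a \<cdot> h = h' \<cdot> c\<rbrakk>
      \<Longrightarrow> Tri S X' Y' Z' f' g' h'"
    and Tri_Ident: "\<lbrakk>X \<in> Ob S; is_zero_object S Z\<rbrakk>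
      \<Longrightarrow> Tri S X X Z (Ident S X) (zero_map S X Z) (zero_map S Z (Susp S X))"
    and Tri_complete: "\<lbrakk>X \<in> Ob S; Y \<in> Ob S; f \<in> homs S X Y\<rbrakk>
      \<Longrightarrow> \<exists>Z g h. Tri S X Y Z f g h"
    and Tri_rotate: "\<lbrakk>X \<in> Ob S; Y \<in> Ob S; Z \<in> Ob S;
        f \<in> homs S X Y; g \<in> homs S Y Z; h \<in> homs S Z (Susp S X)\<rbrakk>
      \<Longrightarrow> Tri S X Y Z f g h \<longleftrightarrow>
          Tri S Y Z (Susp S X) g h (inv\<^bsub>Hom S (Susp S X) (Susp S Y)\<^esub> (SuspM S f))"
    and Tri_morphism: "\<lbrakk>Tri S X Y Z f g h; Tri S X' Y' Z' f' g' h';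
        a \<in> homs S X X'; b \<in> homs S Y Y'; b \<cdot> f = f' \<cdot> a\<rbrakk>
      \<Longrightarrow> \<exists>c \<in> homs S Z Z'. c \<cdot> g = g' \<cdot> b \<and> SuspM S a \<cdot> h = h' \<cdot> c"
    and octahedral: "\<lbrakk>Tri S X Y A f i i'; Tri S Y Z B g j j'; Tri S X Z C (g \<cdot> f) k k'\<rbrakk>
      \<Longrightarrow> \<exists>u \<in> homs S A C. \<exists>v \<in> homs S C B.
            Tri S A C B u v (SuspM S i \<cdot> j') \<and>
            u \<cdot> i = k \<cdot> g \<and> k' \<cdot> u = i' \<and> v \<cdot> k = j \<and> j' \<cdot> v = SuspM S f \<cdot> k'"

definition has_small_coproducts :: "'i set set \<Rightarrow> ('o, 'm) tri_cat \<Rightarrow> bool"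
  where "has_small_coproducts U S \<longleftrightarrow>
    (\<forall>I \<in> U. \<forall>X. (\<forall>i\<in>I. X i \<in> Ob S) \<longrightarrow> (\<exists>C \<iota>. is_coproduct S I X C \<iota>))"


section \<open>Finite objects, phantom maps and projective classes\<close>

text \<open>The product \<open>finprod\<close> is the sum, in \<open>S(W, \<Coprod> X)\<close>, of the composites
  \<open>W \<rightarrow> X i \<rightarrow> \<Coprod> X\<close>; only the finitely many indices with non-zero component contribute.\<close>

definition coproduct_comparison ::
  "('o, 'm) tri_cat \<Rightarrow> 'o \<Rightarrow> 'i set \<Rightarrow> ('i \<Rightarrow> 'o) \<Rightarrow> 'o \<Rightarrow> ('i \<Rightarrow> 'm) \<Rightarrow> ('i \<Rightarrow> 'm) \<Rightarrow> 'm"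
  where "coproduct_comparison S W I X C \<iota> f =
    finprod (Hom S W C) (\<lambda>i. \<iota> i \<cdot>\<^bsub>S\<^esub> f i) {i \<in> I. f i \<noteq> zero_map S W (X i)}"

definition finite_object :: "'i set set \<Rightarrow> ('o, 'm) tri_cat \<Rightarrow> 'o \<Rightarrow> bool"
  where "finite_object U S W \<longleftrightarrow> W \<in> Ob S \<and>
    (\<forall>I \<in> U. \<forall>X C \<iota>. is_coproduct S I X C \<iota> \<longrightarrow>
      coproduct_comparison S W I X C \<iota> \<in> iso (sum_group I (\<lambda>i. Hom S W (X i))) (Hom S W C))"

definition phantom_projectives :: "'i set set \<Rightarrow> ('o, 'm) tri_cat \<Rightarrow> 'o set"
  where "phantom_projectives U S = {P. \<exists>I \<in> U. \<exists>X C \<iota>.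
    (\<forall>i\<in>I. finite_object U S (X i)) \<and> is_coproduct S I X C \<iota> \<and> is_retract S P C}"

definition phantom_maps :: "'i set set \<Rightarrow> ('o, 'm) tri_cat \<Rightarrow> 'o \<Rightarrow> 'o \<Rightarrow> 'm set"
  where "phantom_maps U S X Y = {f \<in> homs S X Y.
    \<forall>W. finite_object U S W \<longrightarrow> (\<forall>w \<in> homs S W X. f \<cdot>\<^bsub>S\<^esub> w = zero_map S W Y)}"

definition projective_class ::
  "('o, 'm) tri_cat \<Rightarrow> 'o set \<Rightarrow> ('o \<Rightarrow> 'o \<Rightarrow> 'm set) \<Rightarrow> bool"
  where "projective_class S \<P> \<I> \<longleftrightarrow>
    (\<forall>X \<in> Ob S. \<forall>Y \<in> Ob S.
      \<I> X Y = {f \<in> homs S X Y. \<forall>P \<in> \<P>. \<forall>p \<in> homs S P X. f \<cdot>\<^bsub>S\<^esub> p = zero_map S P Y}) \<and>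
    \<P> = {P \<in> Ob S. \<forall>X \<in> Ob S. \<forall>Y \<in> Ob S. \<forall>p \<in> homs S P X. \<forall>f \<in> \<I> X Y.
      f \<cdot>\<^bsub>S\<^esub> p = zero_map S P Y} \<and>
    (\<forall>X \<in> Ob S. \<exists>P Y p f h. P \<in> \<P> \<and> f \<in> \<I> X Y \<and> Tri S P X Y p f h)"

definition generates :: "('o, 'm) tri_cat \<Rightarrow> 'o set \<Rightarrow> bool"
  where "generates S \<P> \<longleftrightarrow>
    (\<forall>X \<in> Ob S. \<not> is_zero_object S X \<longrightarrow> (\<exists>P \<in> \<P>. homs S P X \<noteq> {zero_map S P X}))"

definition generating_phantom_projective_class :: "'i set set \<Rightarrow> ('o, 'm) tri_cat \<Rightarrow> bool"
  where "generating_phantom_projective_class U S \<longleftrightarrow>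
    projective_class S (phantom_projectives U S) (phantom_maps U S) \<and>
    generates S (phantom_projectives U S)"


section \<open>Brown categories and projective dimension\<close>

text \<open>Natural transformations \<open>S(-,X) \<rightarrow> S(-,Y)\<close> of contravariant functors from the full
  subcategory of finite objects to abelian groups.\<close>

definition finite_nat_trans ::
  "'i set set \<Rightarrow> ('o, 'm) tri_cat \<Rightarrow> 'o \<Rightarrow> 'o \<Rightarrow> ('o \<Rightarrow> 'm \<Rightarrow> 'm) \<Rightarrow> bool"
  where "finite_nat_trans U S X Y \<tau> \<longleftrightarrow>
    (\<forall>W. finite_object U S W \<longrightarrow> \<tau> W \<in> hom (Hom S W X) (Hom S W Y)) \<and>
    (\<forall>V W. finite_object U S V \<longrightarrow> finite_object U S W \<longrightarrow>
      (\<forall>u \<in> homs S V W. \<forall>f \<in> homs S W X. \<tau> V (f \<cdot>\<^bsub>S\<^esub> u) = \<tau> W f \<cdot>\<^bsub>S\<^esub> u))"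

definition brown_category :: "'i set set \<Rightarrow> ('o, 'm) tri_cat \<Rightarrow> bool"
  where "brown_category U S \<longleftrightarrow>
    (\<forall>X \<in> Ob S. \<forall>Y \<in> Ob S. \<forall>\<tau>. finite_nat_trans U S X Y \<tau> \<longrightarrow>
      (\<exists>h \<in> homs S X Y. \<forall>W. finite_object U S W \<longrightarrow>
        (\<forall>f \<in> homs S W X. \<tau> W f = h \<cdot>\<^bsub>S\<^esub> f)))"

text \<open>\<open>short_exact_sequence A B C f g\<close> lists its groups from right to left: it says that
  \<open>0 \<rightarrow> C \<rightarrow> B \<rightarrow> A \<rightarrow> 0\<close>, with maps \<open>g\<close> and \<open>f\<close>, is exact.\<close>

definition proj_dim_at_most_one :: "('o, 'm) tri_cat \<Rightarrow> 'o set \<Rightarrow> 'o \<Rightarrow> bool"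
  where "proj_dim_at_most_one S \<P> X \<longleftrightarrow>
    (\<exists>P\<^sub>0 \<in> \<P>. \<exists>P\<^sub>1 \<in> \<P>. \<exists>d \<in> homs S P\<^sub>1 P\<^sub>0. \<exists>e \<in> homs S P\<^sub>0 X. \<forall>P \<in> \<P>.
      short_exact_sequence (Hom S P X) (Hom S P P\<^sub>0) (Hom S P P\<^sub>1)
        (\<lambda>f. e \<cdot>\<^bsub>S\<^esub> f) (\<lambda>f. d \<cdot>\<^bsub>S\<^esub> f))"

end

theory Submission
  imports Defs
begin

text \<open>
  The projective class supplies a triangle \<open>W \<rightarrow> P \<rightarrow> X \<rightarrow> \<Sigma>W\<close>, with maps \<open>u\<close>, \<open>e\<close>, \<open>d\<close>, in
  which \<open>P\<close> is projective and \<open>d\<close> is phantom.  Phantom maps vanish on projectives, so \<open>S(Q, -)\<close>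
  turns \<open>W \<rightarrow> P \<rightarrow> X\<close> into a short exact sequence for every projective \<open>Q\<close>
  (\<open>short_exact_on_projective\<close>).  Injectivity of \<open>S(Q, W) \<rightarrow> S(Q, P)\<close> uses that a map killed by
  \<open>u\<close> has a suspension factoring through \<open>d\<close>; as suspensions of finite objects are finite
  (\<open>finite_object_Susp\<close>), such a map is itself phantom (\<open>kernel_phantom\<close>).
  What remains is that \<open>W\<close> is projective, that is, that every phantom \<open>\<phi> : W \<rightarrow> Y\<close> is zero.

  Form the homotopy pushout \<open>E\<close> of \<open>u\<close> and \<open>\<phi>\<close>, with maps \<open>m : P \<rightarrow> E\<close> and \<open>n : Y \<rightarrow> E\<close>; then \<open>m u\<close>
  is \<open>n \<phi>\<close> up to sign, hence phantom.  On finite objects \<open>S(-, X)\<close> is the cokernel of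
  \<open>S(-, W) \<rightarrow> S(-, P)\<close>, so \<open>m\<close> induces a natural transformation \<open>S(-, X) \<rightarrow> S(-, E)\<close>.  The Brown
  property realises it by some \<open>s : X \<rightarrow> E\<close>, and \<open>s e = m\<close> since \<open>P\<close> is projective
  (\<open>brown_extension\<close>).  Therefore \<open>m u = s e u = 0\<close> and \<open>n \<phi> = 0\<close>.  The map
  \<open>(0, \<phi>) : W \<rightarrow> P \<oplus> Y\<close> thus dies in the cone \<open>E\<close> of \<open>(u, \<phi>)\<close>, and exactness provides
  \<open>t : W \<rightarrow> W\<close> with \<open>u t = 0\<close> and \<open>\<phi> t = \<phi>\<close>.  Now \<open>t\<close> and \<open>\<Sigma>t\<close> are phantom, so the cone of \<open>1 - t\<close>
  receives no non-zero map from a finite object; by generation it is zero, and \<open>1 - t\<close> is a split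
  epimorphism (\<open>id_minus_kernel_split_epi\<close>).  From \<open>\<phi> (1 - t) = 0\<close> it follows that \<open>\<phi> = 0\<close>
  (\<open>phantom_from_fiber_zero\<close>).
\<close>


section \<open>Preadditive calculus\<close>

context additive_category
begin

lemma group_Hom: "\<lbrakk>X \<in> Ob S; Y \<in> Ob S\<rbrakk> \<Longrightarrow> group (Hom S X Y)"
  using comm_group_Hom comm_group.axioms(2) by blast

lemma zero_in: "\<lbrakk>X \<in> Ob S; Y \<in> Ob S\<rbrakk> \<Longrightarrow> zero_map S X Y \<in> homs S X Y"
  unfolding zero_map_def homs_def by (simp add: group_Hom group.is_monoid)

lemma inv_in: "\<lbrakk>X \<in> Ob S; Y \<in> Ob S; f \<in> homs S X Y\<rbrakk> \<Longrightarrow> inv\<^bsub>Hom S X Y\<^esub> f \<in> homs S X Y"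
  unfolding homs_def by (simp add: group_Hom group.inv_closed)

lemma sum_in: "\<lbrakk>X \<in> Ob S; Y \<in> Ob S; f \<in> homs S X Y; g \<in> homs S X Y\<rbrakk>
    \<Longrightarrow> f \<otimes>\<^bsub>Hom S X Y\<^esub> g \<in> homs S X Y"
  unfolding homs_def by (simp add: group_Hom group.is_monoid monoid.m_closed)

lemma post_comp_hom: "\<lbrakk>X \<in> Ob S; Y \<in> Ob S; Z \<in> Ob S; g \<in> homs S Y Z\<rbrakk>
    \<Longrightarrow> group_hom (Hom S X Y) (Hom S X Z) (\<lambda>f. g \<cdot> f)"
  by (simp add: group_hom_def group_hom_axioms_def group_Hom Comp_left_additive)

lemma pre_comp_hom: "\<lbrakk>X \<in> Ob S; Y \<in> Ob S; Z \<in> Ob S; f \<in> homs S X Y\<rbrakk>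
    \<Longrightarrow> group_hom (Hom S Y Z) (Hom S X Z) (\<lambda>g. g \<cdot> f)"
  by (simp add: group_hom_def group_hom_axioms_def group_Hom Comp_right_additive)

lemma Comp_zero: "\<lbrakk>X \<in> Ob S; Y \<in> Ob S; Z \<in> Ob S; g \<in> homs S Y Z\<rbrakk>
    \<Longrightarrow> g \<cdot> zero_map S X Y = zero_map S X Z"
  using group_hom.hom_one[OF post_comp_hom] by (simp add: zero_map_def)

lemma zero_Comp: "\<lbrakk>X \<in> Ob S; Y \<in> Ob S; Z \<in> Ob S; f \<in> homs S X Y\<rbrakk>
    \<Longrightarrow> zero_map S Y Z \<cdot> f = zero_map S X Z"
  using group_hom.hom_one[OF pre_comp_hom] by (simp add: zero_map_def)

lemma Comp_inv: "\<lbrakk>X \<in> Ob S; Y \<in> Ob S; Z \<in> Ob S; f \<in> homs S X Y; g \<in> homs S Y Z\<rbrakk>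
    \<Longrightarrow> g \<cdot> (inv\<^bsub>Hom S X Y\<^esub> f) = inv\<^bsub>Hom S X Z\<^esub> (g \<cdot> f)"
  using group_hom.hom_inv[OF post_comp_hom] by (simp add: homs_def)

lemma inv_Comp: "\<lbrakk>X \<in> Ob S; Y \<in> Ob S; Z \<in> Ob S; f \<in> homs S X Y; g \<in> homs S Y Z\<rbrakk>
    \<Longrightarrow> (inv\<^bsub>Hom S Y Z\<^esub> g) \<cdot> f = inv\<^bsub>Hom S X Z\<^esub> (g \<cdot> f)"
  using group_hom.hom_inv[OF pre_comp_hom] by (simp add: homs_def)

lemma Comp_sum: "\<lbrakk>X \<in> Ob S; Y \<in> Ob S; Z \<in> Ob S; f \<in> homs S X Y; f' \<in> homs S X Y; g \<in> homs S Y Z\<rbrakk>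
    \<Longrightarrow> g \<cdot> (f \<otimes>\<^bsub>Hom S X Y\<^esub> f') = (g \<cdot> f) \<otimes>\<^bsub>Hom S X Z\<^esub> (g \<cdot> f')"
  using group_hom.hom_mult[OF post_comp_hom] by (simp add: homs_def)

lemma sum_Comp: "\<lbrakk>X \<in> Ob S; Y \<in> Ob S; Z \<in> Ob S; f \<in> homs S X Y; g \<in> homs S Y Z; g' \<in> homs S Y Z\<rbrakk>
    \<Longrightarrow> (g \<otimes>\<^bsub>Hom S Y Z\<^esub> g') \<cdot> f = (g \<cdot> f) \<otimes>\<^bsub>Hom S X Z\<^esub> (g' \<cdot> f)"
  using group_hom.hom_mult[OF pre_comp_hom] by (simp add: homs_def)

lemma inv_zero_iff: "\<lbrakk>X \<in> Ob S; Y \<in> Ob S; f \<in> homs S X Y\<rbrakk>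
    \<Longrightarrow> inv\<^bsub>Hom S X Y\<^esub> f = zero_map S X Y \<longleftrightarrow> f = zero_map S X Y"
  by (simp add: homs_def zero_map_def group_Hom group.inv_eq_1_iff)

lemma inv_inv_map: "\<lbrakk>X \<in> Ob S; Y \<in> Ob S; f \<in> homs S X Y\<rbrakk>
    \<Longrightarrow> inv\<^bsub>Hom S X Y\<^esub> (inv\<^bsub>Hom S X Y\<^esub> f) = f"
  by (simp add: homs_def group_Hom group.inv_inv)

lemma inv_zero: "\<lbrakk>X \<in> Ob S; Y \<in> Ob S\<rbrakk> \<Longrightarrow> inv\<^bsub>Hom S X Y\<^esub> (zero_map S X Y) = zero_map S X Y"
  using inv_zero_iff zero_in by blast

lemma zero_sum: "\<lbrakk>X \<in> Ob S; Y \<in> Ob S; f \<in> homs S X Y\<rbrakk>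
    \<Longrightarrow> zero_map S X Y \<otimes>\<^bsub>Hom S X Y\<^esub> f = f"
  by (simp add: homs_def zero_map_def group_Hom group.is_monoid)

lemma sum_zero: "\<lbrakk>X \<in> Ob S; Y \<in> Ob S; f \<in> homs S X Y\<rbrakk>
    \<Longrightarrow> f \<otimes>\<^bsub>Hom S X Y\<^esub> zero_map S X Y = f"
  by (simp add: homs_def zero_map_def group_Hom group.is_monoid)

lemma diff_zero_iff: "\<lbrakk>X \<in> Ob S; Y \<in> Ob S; f \<in> homs S X Y; g \<in> homs S X Y\<rbrakk>
    \<Longrightarrow> f \<otimes>\<^bsub>Hom S X Y\<^esub> inv\<^bsub>Hom S X Y\<^esub> g = zero_map S X Y \<longleftrightarrow> f = g"
  unfolding homs_def zero_map_def
  by (metis comm_group_Hom comm_group.axioms(2) group.inv_closed group.inv_equality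
      group.inv_inv group.r_inv)

lemma sum_zero_imp: "\<lbrakk>X \<in> Ob S; Y \<in> Ob S; f \<in> homs S X Y; g \<in> homs S X Y;
    f \<otimes>\<^bsub>Hom S X Y\<^esub> g = zero_map S X Y\<rbrakk> \<Longrightarrow> f = inv\<^bsub>Hom S X Y\<^esub> g"
  unfolding homs_def zero_map_def
  by (metis comm_group_Hom comm_group.axioms(2) group.inv_equality)

lemma is_iso_Ident: "X \<in> Ob S \<Longrightarrow> is_iso S X X (Ident S X)"
  unfolding is_iso_def using Ident_in Comp_Ident by blast

lemma biproduct_maps:
  assumes "X \<in> Ob S" "Y \<in> Ob S"
  obtains B i j p q where "B \<in> Ob S" "i \<in> homs S X B" "j \<in> homs S Y B"
    "p \<in> homs S B X" "q \<in> homs S B Y"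
    "p \<cdot> i = Ident S X" "p \<cdot> j = zero_map S Y X" "q \<cdot> i = zero_map S X Y" "q \<cdot> j = Ident S Y"
proof -
  let ?D = "\<lambda>b. if b then X else Y"
  obtain B \<iota> where "is_coproduct S (UNIV :: bool set) ?D B \<iota>"
    using binary_coproduct_exists[OF assms] by blast
  then have B: "B \<in> Ob S" and \<iota>: "\<And>b. \<iota> b \<in> homs S (?D b) B"
    and univ: "\<And>Z f. Z \<in> Ob S \<Longrightarrow> (\<And>b. f b \<in> homs S (?D b) Z) \<Longrightarrow>
      \<exists>h \<in> homs S B Z. \<forall>b. h \<cdot> \<iota> b = f b"
    unfolding is_coproduct_def by blast+
  have i: "\<iota> True \<in> homs S X B" "\<iota> False \<in> homs S Y B"
    using \<iota>[of True] \<iota>[of False] by auto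
  have "\<exists>h \<in> homs S B X. \<forall>b. h \<cdot> \<iota> b = (if b then Ident S X else zero_map S Y X)"
    using assms by (intro univ) (auto intro: Ident_in zero_in)
  then obtain p where p: "p \<in> homs S B X" "p \<cdot> \<iota> True = Ident S X" "p \<cdot> \<iota> False = zero_map S Y X"
    by auto
  have "\<exists>h \<in> homs S B Y. \<forall>b. h \<cdot> \<iota> b = (if b then zero_map S X Y else Ident S Y)"
    using assms by (intro univ) (auto intro: Ident_in zero_in)
  then obtain q where q: "q \<in> homs S B Y" "q \<cdot> \<iota> True = zero_map S X Y" "q \<cdot> \<iota> False = Ident S Y"
    by auto
  show thesis
    using that B i p q by blast
qed

end


section \<open>Exactness of triangles\<close>

context triangulated_category
begin

lemma SuspM_group_hom: "\<lbrakk>X \<in> Ob S; Y \<in> Ob S\<rbrakk>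
    \<Longrightarrow> group_hom (Hom S X Y) (Hom S (Susp S X) (Susp S Y)) (SuspM S)"
  using SuspM_iso[of X Y] by (simp add: group_hom_def group_hom_axioms_def group_Hom Susp_in iso_iff)

lemma SuspM_in: "\<lbrakk>X \<in> Ob S; Y \<in> Ob S; f \<in> homs S X Y\<rbrakk>
    \<Longrightarrow> SuspM S f \<in> homs S (Susp S X) (Susp S Y)"
  unfolding homs_def using group_hom.hom_closed[OF SuspM_group_hom] by blast

lemma SuspM_zero: "\<lbrakk>X \<in> Ob S; Y \<in> Ob S\<rbrakk>
    \<Longrightarrow> SuspM S (zero_map S X Y) = zero_map S (Susp S X) (Susp S Y)"
  unfolding zero_map_def using group_hom.hom_one[OF SuspM_group_hom] by blast

lemma SuspM_inj: "\<lbrakk>X \<in> Ob S; Y \<in> Ob S; f \<in> homs S X Y; g \<in> homs S X Y; SuspM S f = SuspM S g\<rbrakk>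
    \<Longrightarrow> f = g"
  unfolding homs_def using SuspM_iso[of X Y] by (auto simp: iso_iff dest: inj_onD)

lemma SuspM_surj: "\<lbrakk>X \<in> Ob S; Y \<in> Ob S; g \<in> homs S (Susp S X) (Susp S Y)\<rbrakk>
    \<Longrightarrow> \<exists>f \<in> homs S X Y. SuspM S f = g"
  unfolding homs_def using SuspM_iso[of X Y] by (metis imageE iso_iff)

lemma rotate_Tri: "Tri S X Y Z f g h
    \<Longrightarrow> Tri S Y Z (Susp S X) g h (inv\<^bsub>Hom S (Susp S X) (Susp S Y)\<^esub> (SuspM S f))"
  using Tri_maps Tri_rotate by blast

text \<open>
  The pair \<open>(1, f)\<close> extends to a morphism from the trivial triangle \<open>X \<rightarrow> X \<rightarrow> 0\<close>, which factors \<open>g f\<close>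
  through a zero object.
\<close>

lemma Tri_comp_zero:
  assumes T: "Tri S X Y Z f g h"
  shows "g \<cdot> f = zero_map S X Z"
proof -
  note m = Tri_maps[OF T]
  obtain N where N: "is_zero_object S N"
    using zero_object_exists by blast
  have NO: "N \<in> Ob S"
    using N unfolding is_zero_object_def by blast
  obtain c where c: "c \<in> homs S N Z" "c \<cdot> zero_map S X N = g \<cdot> f"
    using Tri_morphism[OF Tri_Ident[OF _ N] T, of X "Ident S X" f] m Ident_in by auto
  then show ?thesis
    using Comp_zero m NO by metis
qed

lemma Tri_comp_zero': "Tri S X Y Z f g h \<Longrightarrow> h \<cdot> g = zero_map S Y (Susp S X)"
  using Tri_comp_zero[OF rotate_Tri] .

text \<open>
  The map \<open>w\<close> together with \<open>0 \<rightarrow> Z\<close> is a partial morphism from the rotated trivial triangle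
  \<open>V \<rightarrow> 0 \<rightarrow> \<Sigma>V\<close> to the rotated triangle \<open>Y \<rightarrow> Z \<rightarrow> \<Sigma>X\<close>.  Its third component \<open>\<Sigma>V \<rightarrow> \<Sigma>X\<close> is the
  suspension of the factorisation wanted; the two signs introduced by the rotations cancel.
\<close>

lemma Tri_exact:
  assumes T: "Tri S X Y Z f g h" and V: "V \<in> Ob S" and w: "w \<in> homs S V Y"
    and gw: "g \<cdot> w = zero_map S V Z"
  shows "\<exists>t \<in> homs S V X. f \<cdot> t = w"
proof -
  have m: "X \<in> Ob S" "Y \<in> Ob S" "Z \<in> Ob S" "f \<in> homs S X Y" "g \<in> homs S Y Z"
    "h \<in> homs S Z (Susp S X)"
    using Tri_maps[OF T] by auto
  obtain N where N: "is_zero_object S N"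
    using zero_object_exists by blast
  have NO: "N \<in> Ob S"
    using N unfolding is_zero_object_def by blast
  note [simp] = m V w NO Susp_in Ident_in SuspM_in inv_in zero_in
  have R: "Tri S V N (Susp S V) (zero_map S V N) (zero_map S N (Susp S V))
      (inv\<^bsub>Hom S (Susp S V) (Susp S V)\<^esub> (Ident S (Susp S V)))"
    using rotate_Tri[OF Tri_Ident[OF V N]] SuspM_Ident[OF V] by simp
  have "zero_map S N Z \<cdot> zero_map S V N = g \<cdot> w"
    using gw zero_Comp[of V N Z] by simp
  then obtain c where c: "c \<in> homs S (Susp S V) (Susp S X)"
    and eq: "SuspM S w \<cdot> inv\<^bsub>Hom S (Susp S V) (Susp S V)\<^esub> (Ident S (Susp S V))
      = (inv\<^bsub>Hom S (Susp S X) (Susp S Y)\<^esub> (SuspM S f)) \<cdot> c"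
    using Tri_morphism[OF R rotate_Tri[OF T], of w "zero_map S N Z"] by auto
  obtain t where t: "t \<in> homs S V X" "SuspM S t = c"
    using SuspM_surj[of V X c] c by auto
  have "inv\<^bsub>Hom S (Susp S V) (Susp S Y)\<^esub> (SuspM S w)
      = inv\<^bsub>Hom S (Susp S V) (Susp S Y)\<^esub> (SuspM S f \<cdot> c)"
    using eq c Comp_inv[of "Susp S V" "Susp S V" "Susp S Y" "Ident S (Susp S V)" "SuspM S w"]
      inv_Comp[of "Susp S V" "Susp S X" "Susp S Y" c "SuspM S f"]
      Comp_Ident[of "Susp S V" "Susp S Y" "SuspM S w"] by simp
  then have "SuspM S w = SuspM S f \<cdot> c"
    using inv_inv_map c by (metis Comp_in SuspM_in Susp_in m(1,2,4) V w)
  then have "SuspM S w = SuspM S (f \<cdot> t)"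
    using t SuspM_Comp[of V X Y t f] by simp
  then have "w = f \<cdot> t"
    using t SuspM_inj[of V Y w "f \<cdot> t"] Comp_in[of V X Y t f] by simp
  then show ?thesis
    using t by blast
qed

lemma Tri_exact_shifted:
  assumes T: "Tri S X Y Z f g h" and V: "V \<in> Ob S" and w: "w \<in> homs S V X"
    and fw: "f \<cdot> w = zero_map S V Y"
  shows "\<exists>r \<in> homs S (Susp S V) Z. h \<cdot> r = SuspM S w"
proof -
  have m: "X \<in> Ob S" "Y \<in> Ob S" "Z \<in> Ob S" "f \<in> homs S X Y" "g \<in> homs S Y Z"
    "h \<in> homs S Z (Susp S X)"
    using Tri_maps[OF T] by auto
  have "SuspM S f \<cdot> SuspM S w = zero_map S (Susp S V) (Susp S Y)"
    using SuspM_Comp[of V X Y w f] SuspM_zero[of V Y] fw m V w by simp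
  then have "(inv\<^bsub>Hom S (Susp S X) (Susp S Y)\<^esub> (SuspM S f)) \<cdot> SuspM S w
      = zero_map S (Susp S V) (Susp S Y)"
    using inv_Comp[of "Susp S V" "Susp S X" "Susp S Y" "SuspM S w" "SuspM S f"] inv_zero
      m V w Susp_in SuspM_in by simp
  then show ?thesis
    using Tri_exact[OF rotate_Tri[OF rotate_Tri[OF T]], of "Susp S V" "SuspM S w"]
      m V w Susp_in SuspM_in by blast
qed

text \<open>
  A triangle starting with \<open>P \<rightarrow> X\<close> extends to the left because the cone is, up to isomorphism, a
  suspension.  Rotation demands that the last map be \<open>-\<Sigma>u\<close>, whence the sign in the choice of
  \<open>u\<close>.
\<close>

lemma desuspend_cone:
  assumes T: "Tri S P X V e f h"
  obtains W u b where "Tri S W P X u e (b \<cdot> f)" "b \<in> homs S V (Susp S W)"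
proof -
  have m: "P \<in> Ob S" "X \<in> Ob S" "V \<in> Ob S" "e \<in> homs S P X" "f \<in> homs S X V"
    "h \<in> homs S V (Susp S P)"
    using Tri_maps[OF T] by auto
  obtain W a where W: "W \<in> Ob S" and "is_iso S (Susp S W) V a"
    using Susp_ess_surj[of V] m by blast
  then obtain b where a: "a \<in> homs S (Susp S W) V" and b: "b \<in> homs S V (Susp S W)"
    and ba: "b \<cdot> a = Ident S (Susp S W)" and ab: "a \<cdot> b = Ident S V"
    unfolding is_iso_def by blast
  have iso_b: "is_iso S V (Susp S W) b"
    unfolding is_iso_def using a b ba ab by blast
  note [simp] = m W a b Susp_in
  have [simp]: "h \<cdot> a \<in> homs S (Susp S W) (Susp S P)" "b \<cdot> f \<in> homs S X (Susp S W)"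
    using Comp_in[of "Susp S W" V "Susp S P" a h] Comp_in[of X V "Susp S W" f b] by auto
  have "(h \<cdot> a) \<cdot> b = h"
    using Comp_assoc[of V "Susp S W" V "Susp S P" b a h] ab Comp_Ident[of V "Susp S P" h] by simp
  then have T': "Tri S P X (Susp S W) e (b \<cdot> f) (h \<cdot> a)"
    using Comp_Ident[of X "Susp S W" "b \<cdot> f"] Ident_Comp[of P X e] Comp_Ident[of P X e]
      Ident_Comp[of V "Susp S P" h] SuspM_Ident[of P]
    by (intro Tri_iso[OF T _ _ _ _ _ _ is_iso_Ident is_iso_Ident iso_b]) auto
  obtain v where v: "v \<in> homs S W P" "SuspM S v = h \<cdot> a"
    using SuspM_surj[of W P "h \<cdot> a"] by auto
  define u where "u = inv\<^bsub>Hom S W P\<^esub> v"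
  have u: "u \<in> homs S W P"
    unfolding u_def using v inv_in by simp
  have "SuspM S u = inv\<^bsub>Hom S (Susp S W) (Susp S P)\<^esub> (h \<cdot> a)"
    unfolding u_def using group_hom.hom_inv[OF SuspM_group_hom[of W P], of v] v
    by (simp add: homs_def)
  then have "inv\<^bsub>Hom S (Susp S W) (Susp S P)\<^esub> (SuspM S u) = h \<cdot> a"
    using inv_inv_map by simp
  then have "Tri S W P X u e (b \<cdot> f)"
    using T' u Tri_rotate[of W P X u e "b \<cdot> f"] by simp
  then show thesis
    using b that by blast
qed

end


section \<open>Suspensions of finite objects\<close>

lemma hom_finprod:
  assumes "comm_group G" "comm_group H" "h \<in> hom G H" "f \<in> A \<rightarrow> carrier G"
  shows "h (finprod G f A) = finprod H (\<lambda>i. h (f i)) A"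
proof -
  interpret G: comm_group G by fact
  interpret H: comm_group H by fact
  interpret group_hom G H h
    using assms(3) by unfold_locales
  show ?thesis
    using assms(4)
  proof (induction A rule: infinite_finite_induct)
    case (insert a A)
    then have "(\<lambda>i. h (f i)) \<in> insert a A \<rightarrow> carrier H"
      by (auto simp: Pi_def)
    with insert show ?case
      by (simp add: Pi_def)
  qed auto
qed

lemma sum_group_iso:
  assumes A: "\<And>i. i \<in> I \<Longrightarrow> group (A i)" and B: "\<And>i. i \<in> I \<Longrightarrow> group (B i)"
    and \<beta>: "\<And>i. i \<in> I \<Longrightarrow> \<beta> i \<in> iso (A i) (B i)"
  shows "(\<lambda>x. \<lambda>i\<in>I. \<beta> i (x i)) \<in> iso (sum_group I A) (sum_group I B)"
proof -
  let ?b = "\<lambda>x. \<lambda>i\<in>I. \<beta> i (x i)"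
  have hom: "\<beta> i \<in> hom (A i) (B i)" if "i \<in> I" for i
    using \<beta>[OF that] by (simp add: iso_iff)
  have one: "\<beta> i z = \<one>\<^bsub>B i\<^esub> \<longleftrightarrow> z = \<one>\<^bsub>A i\<^esub>" if "i \<in> I" "z \<in> carrier (A i)" for i z
    using \<beta>[OF that(1)] that(2) hom_one[OF hom A B] A[OF that(1)] that(1)
    by (metis group.is_monoid inj_onD iso_iff monoid.one_closed)
  have maps: "?b x \<in> carrier (sum_group I B)" if "x \<in> carrier (sum_group I A)" for x
  proof -
    have x: "x \<in> (\<Pi>\<^sub>E i\<in>I. carrier (A i))" "finite {i \<in> I. x i \<noteq> \<one>\<^bsub>A i\<^esub>}"
      using that by (auto simp: carrier_sum_group A)
    have "{i \<in> I. ?b x i \<noteq> \<one>\<^bsub>B i\<^esub>} = {i \<in> I. x i \<noteq> \<one>\<^bsub>A i\<^esub>}"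
      using x one by (auto simp: PiE_iff)
    then show ?thesis
      using x hom by (auto simp: carrier_sum_group B PiE_iff hom_def Pi_def)
  qed
  have mult: "?b (x \<otimes>\<^bsub>sum_group I A\<^esub> y) = ?b x \<otimes>\<^bsub>sum_group I B\<^esub> ?b y"
    if "x \<in> carrier (sum_group I A)" "y \<in> carrier (sum_group I A)" for x y
    using that hom by (auto simp: carrier_sum_group A PiE_iff hom_def intro!: restrict_ext)
  have inj: "x = y" if "x \<in> carrier (sum_group I A)" "y \<in> carrier (sum_group I A)" "?b x = ?b y" for x y
  proof (rule PiE_ext)
    show "x \<in> (\<Pi>\<^sub>E i\<in>I. carrier (A i))" "y \<in> (\<Pi>\<^sub>E i\<in>I. carrier (A i))"
      using that by (auto simp: carrier_sum_group A)
    fix i assume i: "i \<in> I"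
    have "\<beta> i (x i) = \<beta> i (y i)"
      using fun_cong[OF that(3), of i] i by simp
    then show "x i = y i"
      using \<beta>[OF i] that i by (auto simp: carrier_sum_group A PiE_iff iso_iff dest: inj_onD)
  qed
  have surj: "\<exists>x \<in> carrier (sum_group I A). ?b x = y" if y: "y \<in> carrier (sum_group I B)" for y
  proof -
    have y': "y \<in> (\<Pi>\<^sub>E i\<in>I. carrier (B i))" "finite {i \<in> I. y i \<noteq> \<one>\<^bsub>B i\<^esub>}"
      using y by (auto simp: carrier_sum_group B)
    have "\<forall>i\<in>I. \<exists>z. z \<in> carrier (A i) \<and> \<beta> i z = y i"
      using \<beta> y' by (auto simp: iso_iff PiE_iff) (metis imageE)
    then obtain x where x: "\<And>i. i \<in> I \<Longrightarrow> x i \<in> carrier (A i)" "\<And>i. i \<in> I \<Longrightarrow> \<beta> i (x i) = y i"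
      by metis
    have "{i \<in> I. restrict x I i \<noteq> \<one>\<^bsub>A i\<^esub>} = {i \<in> I. y i \<noteq> \<one>\<^bsub>B i\<^esub>}"
      using x one by auto (metis, metis)
    then have "restrict x I \<in> carrier (sum_group I A)"
      using x y' by (simp add: carrier_sum_group A cong: conj_cong)
    moreover have "?b (restrict x I) = y"
      using x y' by (auto simp: fun_eq_iff PiE_iff extensional_def)
    ultimately show ?thesis
      by blast
  qed
  show ?thesis
    unfolding iso_iff hom_def using maps mult inj surj
    by (auto simp: inj_on_def image_iff Pi_def) metis+
qed

context triangulated_category
begin

lemma post_comp_iso:
  assumes V: "V \<in> Ob S" "X \<in> Ob S" "Y \<in> Ob S" and a: "is_iso S X Y a"
  shows "(\<lambda>f. a \<cdot> f) \<in> iso (Hom S V X) (Hom S V Y)"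
proof -
  obtain b where ab: "a \<in> homs S X Y" "b \<in> homs S Y X" "b \<cdot> a = Ident S X" "a \<cdot> b = Ident S Y"
    using a unfolding is_iso_def by blast
  have "bij_betw (\<lambda>f. a \<cdot> f) (homs S V X) (homs S V Y)"
  proof (rule bij_betw_byWitness[where f' = "\<lambda>f. b \<cdot> f"])
    show "\<forall>f\<in>homs S V X. b \<cdot> (a \<cdot> f) = f"
      using Comp_assoc[of V X Y X _ a b] Ident_Comp ab V by metis
    show "\<forall>f\<in>homs S V Y. a \<cdot> (b \<cdot> f) = f"
      using Comp_assoc[of V Y X Y _ b a] Ident_Comp ab V by metis
  qed (use Comp_in V ab in blast)+
  then show ?thesis
    using Comp_left_additive V ab by (simp add: iso_def homs_def)
qed

text \<open>
  The maps \<open>\<iota>'\<close> are the injections \<open>\<iota>\<close> transported along the equivalence \<open>\<Sigma>\<close> and the isomorphisms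
  \<open>\<Sigma>X' \<cong> X\<close> and \<open>\<Sigma>C' \<cong> C\<close>, and an equivalence reflects universal properties.
\<close>

lemma desuspend_coproduct:
  assumes cop: "is_coproduct S I X C \<iota>"
    and X': "\<And>i. i \<in> I \<Longrightarrow> X' i \<in> Ob S" and a: "\<And>i. i \<in> I \<Longrightarrow> is_iso S (Susp S (X' i)) (X i) (a i)"
    and C': "C' \<in> Ob S" and c: "is_iso S (Susp S C') C c"
    and \<iota>': "\<And>i. i \<in> I \<Longrightarrow> \<iota>' i \<in> homs S (X' i) C'"
    and eq: "\<And>i. i \<in> I \<Longrightarrow> c \<cdot> SuspM S (\<iota>' i) = \<iota> i \<cdot> a i"
  shows "is_coproduct S I X' C' \<iota>'"
proof -
  have C: "C \<in> Ob S" and X: "\<And>i. i \<in> I \<Longrightarrow> X i \<in> Ob S" and \<iota>: "\<And>i. i \<in> I \<Longrightarrow> \<iota> i \<in> homs S (X i) C"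
    and univ: "\<And>Y f. Y \<in> Ob S \<Longrightarrow> (\<And>i. i \<in> I \<Longrightarrow> f i \<in> homs S (X i) Y) \<Longrightarrow>
      \<exists>!h. h \<in> homs S C Y \<and> (\<forall>i\<in>I. h \<cdot> \<iota> i = f i)"
    using cop unfolding is_coproduct_def by blast+
  have "\<forall>i\<in>I. \<exists>b. b \<in> homs S (X i) (Susp S (X' i)) \<and> b \<cdot> a i = Ident S (Susp S (X' i)) \<and>
      a i \<cdot> b = Ident S (X i)"
    using a unfolding is_iso_def by blast
  then obtain b where b: "\<And>i. i \<in> I \<Longrightarrow> b i \<in> homs S (X i) (Susp S (X' i))"
    and ba: "\<And>i. i \<in> I \<Longrightarrow> b i \<cdot> a i = Ident S (Susp S (X' i))"
    and ab: "\<And>i. i \<in> I \<Longrightarrow> a i \<cdot> b i = Ident S (X i)"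
    by metis
  obtain d where cin: "c \<in> homs S (Susp S C') C" and d: "d \<in> homs S C (Susp S C')"
    and dc: "d \<cdot> c = Ident S (Susp S C')"
    using c unfolding is_iso_def by blast
  have ain: "\<And>i. i \<in> I \<Longrightarrow> a i \<in> homs S (Susp S (X' i)) (X i)"
    using a unfolding is_iso_def by blast
  note [simp] = C X X' C' Susp_in
  have "\<exists>!h. h \<in> homs S C' Y \<and> (\<forall>i\<in>I. h \<cdot> \<iota>' i = f i)"
    if Y[simp]: "Y \<in> Ob S" and f: "\<And>i. i \<in> I \<Longrightarrow> f i \<in> homs S (X' i) Y" for Y f
  proof -
    have g: "SuspM S (f i) \<cdot> b i \<in> homs S (X i) (Susp S Y)" if i: "i \<in> I" for i
      using Comp_in[of "X i" "Susp S (X' i)" "Susp S Y"] SuspM_in f b i by simp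
    have ex1: "\<exists>!k. k \<in> homs S C (Susp S Y) \<and> (\<forall>i\<in>I. k \<cdot> \<iota> i = SuspM S (f i) \<cdot> b i)"
      by (rule univ) (use g Y Susp_in in blast)+
    then obtain k where k: "k \<in> homs S C (Susp S Y)"
      and k\<iota>: "\<And>i. i \<in> I \<Longrightarrow> k \<cdot> \<iota> i = SuspM S (f i) \<cdot> b i"
      by blast
    have k_unique: "k' = k" if "k' \<in> homs S C (Susp S Y)"
      "\<And>i. i \<in> I \<Longrightarrow> k' \<cdot> \<iota> i = SuspM S (f i) \<cdot> b i" for k'
      using ex1 k k\<iota> that by blast
    obtain h where h: "h \<in> homs S C' Y" and hk: "SuspM S h = k \<cdot> c"
      using SuspM_surj[of C' Y "k \<cdot> c"] Comp_in[of "Susp S C'" C "Susp S Y" c k] k cin by auto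
    have h\<iota>: "h \<cdot> \<iota>' i = f i" if i: "i \<in> I" for i
    proof -
      have "SuspM S (h \<cdot> \<iota>' i) = (k \<cdot> c) \<cdot> SuspM S (\<iota>' i)"
        using SuspM_Comp[of "X' i" C' Y "\<iota>' i" h] \<iota>' h hk i by simp
      also have "\<dots> = k \<cdot> (\<iota> i \<cdot> a i)"
        using Comp_assoc[of "Susp S (X' i)" "Susp S C'" C "Susp S Y" "SuspM S (\<iota>' i)" c k]
          SuspM_in \<iota>' i cin k eq by simp
      also have "\<dots> = (SuspM S (f i) \<cdot> b i) \<cdot> a i"
        using Comp_assoc[of "Susp S (X' i)" "X i" C "Susp S Y" "a i" "\<iota> i" k] i ain \<iota> k k\<iota> by simp
      also have "\<dots> = SuspM S (f i)"
        using Comp_assoc[of "Susp S (X' i)" "X i" "Susp S (X' i)" "Susp S Y" "a i" "b i" "SuspM S (f i)"]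
          i ain b ba SuspM_in f Comp_Ident[of "Susp S (X' i)" "Susp S Y" "SuspM S (f i)"] by simp
      finally show ?thesis
        using SuspM_inj[of "X' i" Y "h \<cdot> \<iota>' i" "f i"] Comp_in[of "X' i" C' Y "\<iota>' i" h] i h \<iota>' f by simp
    qed
    have "h' = h" if h': "h' \<in> homs S C' Y" and h'\<iota>: "\<And>i. i \<in> I \<Longrightarrow> h' \<cdot> \<iota>' i = f i" for h'
    proof -
      have "(SuspM S h' \<cdot> d) \<cdot> \<iota> i = SuspM S (f i) \<cdot> b i" if i: "i \<in> I" for i
      proof -
        have "\<iota> i = (\<iota> i \<cdot> a i) \<cdot> b i"
          using Comp_assoc[of "X i" "Susp S (X' i)" "X i" C "b i" "a i" "\<iota> i"] ab i ain b \<iota> Comp_Ident[of "X i" C "\<iota> i"]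
          by simp
        also have "\<dots> = c \<cdot> (SuspM S (\<iota>' i) \<cdot> b i)"
          using Comp_assoc[of "X i" "Susp S (X' i)" "Susp S C'" C "b i" "SuspM S (\<iota>' i)" c] i b \<iota>' cin SuspM_in eq
          by simp
        finally have e: "\<iota> i = c \<cdot> (SuspM S (\<iota>' i) \<cdot> b i)" .
        have w: "SuspM S (\<iota>' i) \<cdot> b i \<in> homs S (X i) (Susp S C')"
          using Comp_in[of "X i" "Susp S (X' i)" "Susp S C'"] i b \<iota>' SuspM_in by simp
        have "d \<cdot> \<iota> i = SuspM S (\<iota>' i) \<cdot> b i"
          using e Comp_assoc[of "X i" "Susp S C'" C "Susp S C'" _ c d] w cin d dc i Ident_Comp[OF _ _ w]
          by simp
        then have "(SuspM S h' \<cdot> d) \<cdot> \<iota> i = SuspM S h' \<cdot> (SuspM S (\<iota>' i) \<cdot> b i)"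
          using Comp_assoc[of "X i" C "Susp S C'" "Susp S Y" "\<iota> i" d "SuspM S h'"] i \<iota> d h' SuspM_in by simp
        also have "\<dots> = SuspM S (f i) \<cdot> b i"
          using Comp_assoc[of "X i" "Susp S (X' i)" "Susp S C'" "Susp S Y" "b i" "SuspM S (\<iota>' i)" "SuspM S h'"]
            SuspM_Comp[of "X' i" C' Y "\<iota>' i" h'] h'\<iota> i b \<iota>' h' SuspM_in by simp
        finally show ?thesis .
      qed
      then have "SuspM S h' \<cdot> d = k"
        using k_unique Comp_in[of C "Susp S C'" "Susp S Y" d "SuspM S h'"] d h' SuspM_in by simp
      then have "SuspM S h' = SuspM S h"
        using hk Comp_assoc[of "Susp S C'" C "Susp S C'" "Susp S Y" c d "SuspM S h'"] cin d dc h' SuspM_in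
          Comp_Ident[of "Susp S C'" "Susp S Y" "SuspM S h'"] by simp
      then show ?thesis
        using SuspM_inj[of C' Y h' h] h h' by simp
    qed
    then show ?thesis
      using h h\<iota> by blast
  qed
  then show ?thesis
    unfolding is_coproduct_def using \<iota>' by simp
qed

text \<open>
  Every coproduct diagram is, up to isomorphism, the suspension of another one.  Along the
  isomorphisms \<open>S(F, X') \<cong> S(\<Sigma>F, \<Sigma>X') \<cong> S(\<Sigma>F, X)\<close> the comparison map of \<open>\<Sigma>F\<close> for the given diagram
  corresponds to that of \<open>F\<close> for the desuspended one.
\<close>

lemma finite_object_Susp:
  assumes F: "finite_object U S F"
  shows "finite_object U S (Susp S F)"
proof -
  have FO[simp]: "F \<in> Ob S"
    using F unfolding finite_object_def by blast
  have "coproduct_comparison S (Susp S F) I X C \<iota>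
      \<in> iso (sum_group I (\<lambda>i. Hom S (Susp S F) (X i))) (Hom S (Susp S F) C)"
    if I: "I \<in> U" and cop: "is_coproduct S I X C \<iota>" for I X C \<iota>
  proof -
    have C: "C \<in> Ob S" and X: "\<And>i. i \<in> I \<Longrightarrow> X i \<in> Ob S"
      and \<iota>: "\<And>i. i \<in> I \<Longrightarrow> \<iota> i \<in> homs S (X i) C"
      using cop unfolding is_coproduct_def by blast+
    obtain C' c where C': "C' \<in> Ob S" and c: "is_iso S (Susp S C') C c"
      using Susp_ess_surj[OF C] by blast
    have "\<forall>i\<in>I. \<exists>X' a. X' \<in> Ob S \<and> is_iso S (Susp S X') (X i) a"
      using Susp_ess_surj X by blast
    then obtain X' a where X': "\<And>i. i \<in> I \<Longrightarrow> X' i \<in> Ob S"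
      and a: "\<And>i. i \<in> I \<Longrightarrow> is_iso S (Susp S (X' i)) (X i) (a i)"
      by metis
    note [simp] = C X X' C' Susp_in
    have ain: "\<And>i. i \<in> I \<Longrightarrow> a i \<in> homs S (Susp S (X' i)) (X i)"
      using a unfolding is_iso_def by blast
    have cin: "c \<in> homs S (Susp S C') C"
      using c unfolding is_iso_def by blast
    define A where "A f = c \<cdot> SuspM S f" for f
    define \<alpha> where "\<alpha> i f = a i \<cdot> SuspM S f" for i f
    have A: "A \<in> iso (Hom S V C') (Hom S (Susp S V) C)" if "V \<in> Ob S" for V
      using iso_set_trans[OF SuspM_iso post_comp_iso[OF _ _ _ c]] that
      unfolding A_def comp_def by simp
    have \<alpha>: "\<alpha> i \<in> iso (Hom S F (X' i)) (Hom S (Susp S F) (X i))" if "i \<in> I" for i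
      using iso_set_trans[OF SuspM_iso post_comp_iso[OF _ _ _ a[OF that]]] that
      unfolding \<alpha>_def comp_def by simp
    have "\<exists>t. t \<in> homs S (X' i) C' \<and> A t = \<iota> i \<cdot> a i" if i: "i \<in> I" for i
    proof -
      have "\<iota> i \<cdot> a i \<in> homs S (Susp S (X' i)) C"
        using Comp_in[of "Susp S (X' i)" "X i" C] i \<iota> ain by simp
      then show ?thesis
        using A[of "X' i"] i unfolding iso_iff homs_def by (metis X' imageE)
    qed
    then obtain \<iota>' where \<iota>': "\<And>i. i \<in> I \<Longrightarrow> \<iota>' i \<in> homs S (X' i) C'"
      and A\<iota>': "\<And>i. i \<in> I \<Longrightarrow> A (\<iota>' i) = \<iota> i \<cdot> a i"
      by metis
    have "is_coproduct S I X' C' \<iota>'"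
      using desuspend_coproduct[OF cop X' a C' c \<iota>'] A\<iota>' unfolding A_def by blast
    then have cmp: "coproduct_comparison S F I X' C' \<iota>'
        \<in> iso (sum_group I (\<lambda>i. Hom S F (X' i))) (Hom S F C')"
      using F I unfolding finite_object_def by blast
    define \<beta> where "\<beta> i = inv_into (homs S F (X' i)) (\<alpha> i)" for i
    have \<beta>: "\<beta> i \<in> iso (Hom S (Susp S F) (X i)) (Hom S F (X' i))" if "i \<in> I" for i
      using group.iso_set_sym[OF _ \<alpha>] that group_Hom unfolding \<beta>_def homs_def by simp
    have \<alpha>\<beta>: "\<alpha> i (\<beta> i x) = x" if "i \<in> I" "x \<in> homs S (Susp S F) (X i)" for i x
      using \<alpha>[OF that(1)] that(2) unfolding \<beta>_def homs_def by (simp add: f_inv_into_f iso_iff)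
    have \<beta>in: "\<beta> i x \<in> homs S F (X' i)" if "i \<in> I" "x \<in> homs S (Susp S F) (X i)" for i x
      using \<beta>[OF that(1)] that(2) by (auto simp: iso_iff hom_def homs_def)
    have \<beta>zero: "\<beta> i x = zero_map S F (X' i) \<longleftrightarrow> x = zero_map S (Susp S F) (X i)"
      if "i \<in> I" "x \<in> homs S (Susp S F) (X i)" for i x
    proof -
      have "inj_on (\<beta> i) (homs S (Susp S F) (X i))"
        using \<beta>[OF that(1)] by (simp add: iso_iff homs_def)
      moreover have "\<beta> i (zero_map S (Susp S F) (X i)) = zero_map S F (X' i)"
        unfolding zero_map_def using hom_one[OF iso_imp_homomorphism[OF \<beta>[OF that(1)]]] that(1) group_Hom
        by simp
      ultimately show ?thesis
        using that zero_in[of "Susp S F" "X i"] by (metis FO Susp_in X inj_onD)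
    qed
    let ?b = "\<lambda>x. \<lambda>i\<in>I. \<beta> i (x i)"
    have grp: "\<And>i. i \<in> I \<Longrightarrow> group (Hom S (Susp S F) (X i))" "\<And>i. i \<in> I \<Longrightarrow> group (Hom S F (X' i))"
      using group_Hom by simp_all
    have "?b \<in> iso (sum_group I (\<lambda>i. Hom S (Susp S F) (X i))) (sum_group I (\<lambda>i. Hom S F (X' i)))"
      by (intro sum_group_iso grp \<beta>)
    from iso_set_trans[OF iso_set_trans[OF this cmp] A[OF FO]]
    have iso: "(\<lambda>x. A (coproduct_comparison S F I X' C' \<iota>' (?b x)))
        \<in> iso (sum_group I (\<lambda>i. Hom S (Susp S F) (X i))) (Hom S (Susp S F) C)"
      by (simp add: comp_def)
    have "coproduct_comparison S (Susp S F) I X C \<iota> x = A (coproduct_comparison S F I X' C' \<iota>' (?b x))"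
      if "x \<in> carrier (sum_group I (\<lambda>i. Hom S (Susp S F) (X i)))" for x
    proof -
      have x: "x i \<in> homs S (Susp S F) (X i)" if "i \<in> I" for i
        using \<open>x \<in> _\<close> that grp by (auto simp: carrier_sum_group PiE_iff homs_def)
      let ?J = "{i \<in> I. x i \<noteq> zero_map S (Susp S F) (X i)}"
      have J: "{i \<in> I. ?b x i \<noteq> zero_map S F (X' i)} = ?J"
        using \<beta>zero x by auto
      have sm: "\<iota>' i \<cdot> \<beta> i (x i) \<in> homs S F C'" if "i \<in> I" for i
        using Comp_in[of F "X' i" C'] that \<iota>' \<beta>in x by simp
      have "A (coproduct_comparison S F I X' C' \<iota>' (?b x))
          = A (finprod (Hom S F C') (\<lambda>i. \<iota>' i \<cdot> ?b x i) ?J)"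
        unfolding coproduct_comparison_def J ..
      also have "\<dots> = finprod (Hom S (Susp S F) C) (\<lambda>i. A (\<iota>' i \<cdot> ?b x i)) ?J"
        using A[OF FO] sm by (intro hom_finprod comm_group_Hom) (auto simp: iso_iff homs_def)
      also have "\<dots> = finprod (Hom S (Susp S F) C) (\<lambda>i. \<iota> i \<cdot> x i) ?J"
      proof (rule comm_monoid.finprod_cong')
        show "comm_monoid (Hom S (Susp S F) C)"
          using comm_group_Hom[of "Susp S F" C] comm_group.axioms(1) by simp
        show "(\<lambda>i. \<iota> i \<cdot> x i) \<in> ?J \<rightarrow> carrier (Hom S (Susp S F) C)"
          using Comp_in x \<iota> by (simp add: Pi_def homs_def[symmetric]) (metis C FO Susp_in X)
        fix i assume "i \<in> ?J"
        then have i[simp]: "i \<in> I" by simp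
        have b: "\<beta> i (x i) \<in> homs S F (X' i)"
          using \<beta>in x by simp
        have "A (\<iota>' i \<cdot> \<beta> i (x i)) = A (\<iota>' i) \<cdot> SuspM S (\<beta> i (x i))"
          unfolding A_def using SuspM_Comp[of F "X' i" C' "\<beta> i (x i)" "\<iota>' i"] b \<iota>' SuspM_in cin
            Comp_assoc[of "Susp S F" "Susp S (X' i)" "Susp S C'" C "SuspM S (\<beta> i (x i))" "SuspM S (\<iota>' i)" c]
          by simp
        also have "\<dots> = \<iota> i \<cdot> \<alpha> i (\<beta> i (x i))"
          unfolding A\<iota>'[OF i] \<alpha>_def using b \<iota> ain SuspM_in
            Comp_assoc[of "Susp S F" "Susp S (X' i)" "X i" C "SuspM S (\<beta> i (x i))" "a i" "\<iota> i"] by simp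
        finally show "A (\<iota>' i \<cdot> ?b x i) = \<iota> i \<cdot> x i"
          using \<alpha>\<beta> x by simp
      qed simp
      finally show ?thesis
        unfolding coproduct_comparison_def by simp
    qed
    moreover have "group (sum_group I (\<lambda>i. Hom S (Susp S F) (X i)))"
      by (intro sum_group grp)
    ultimately show ?thesis
      using iso by (intro group.iso_eq[OF _ iso]) simp_all
  qed
  then show ?thesis
    unfolding finite_object_def using Susp_in[OF FO] by blast
qed

end


section \<open>Phantom maps and phantom resolutions\<close>

locale phantom_projective_category = triangulated_category S
  for S :: "('o, 'm) tri_cat" (structure) +
  fixes U :: "'i set set"
  assumes phantom_class: "generating_phantom_projective_class U S"
begin

abbreviation "\<P> \<equiv> phantom_projectives U S"
abbreviation "\<I> \<equiv> phantom_maps U S"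

lemma finite_Ob: "finite_object U S F \<Longrightarrow> F \<in> Ob S"
  unfolding finite_object_def by blast

lemma phantom_in: "f \<in> \<I> X Y \<Longrightarrow> f \<in> homs S X Y"
  unfolding phantom_maps_def by blast

lemma phantom_finite:
  "\<lbrakk>f \<in> \<I> X Y; finite_object U S F; w \<in> homs S F X\<rbrakk> \<Longrightarrow> f \<cdot> w = zero_map S F Y"
  unfolding phantom_maps_def by blast

lemma phantomI:
  "\<lbrakk>f \<in> homs S X Y; \<And>F w. \<lbrakk>finite_object U S F; w \<in> homs S F X\<rbrakk> \<Longrightarrow> f \<cdot> w = zero_map S F Y\<rbrakk>
    \<Longrightarrow> f \<in> \<I> X Y"
  unfolding phantom_maps_def by blast

lemma phantom_projective:
  "\<lbrakk>X \<in> Ob S; Y \<in> Ob S; f \<in> \<I> X Y; P \<in> \<P>; p \<in> homs S P X\<rbrakk> \<Longrightarrow> f \<cdot> p = zero_map S P Y"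
  using phantom_class unfolding generating_phantom_projective_class_def projective_class_def by blast

lemma projective_iff: "P \<in> \<P> \<longleftrightarrow> P \<in> Ob S \<and>
    (\<forall>X \<in> Ob S. \<forall>Y \<in> Ob S. \<forall>p \<in> homs S P X. \<forall>f \<in> \<I> X Y. f \<cdot> p = zero_map S P Y)"
  using phantom_class unfolding generating_phantom_projective_class_def projective_class_def by blast

lemma projective_Ob: "P \<in> \<P> \<Longrightarrow> P \<in> Ob S"
  using projective_iff by blast

lemma phantom_precomp:
  assumes O: "V \<in> Ob S" "X \<in> Ob S" "Y \<in> Ob S" and f: "f \<in> \<I> X Y" and g: "g \<in> homs S V X"
  shows "f \<cdot> g \<in> \<I> V Y"
proof (rule phantomI)
  show "f \<cdot> g \<in> homs S V Y"
    using Comp_in O g phantom_in[OF f] by blast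
  fix F w assume F: "finite_object U S F" and w: "w \<in> homs S F V"
  then show "(f \<cdot> g) \<cdot> w = zero_map S F Y"
    using Comp_assoc[of F V X Y w g f] O g phantom_in[OF f] finite_Ob[OF F]
      phantom_finite[OF f F] Comp_in by metis
qed

lemma phantom_postcomp:
  assumes O: "X \<in> Ob S" "Y \<in> Ob S" "Z \<in> Ob S" and f: "f \<in> \<I> X Y" and g: "g \<in> homs S Y Z"
  shows "g \<cdot> f \<in> \<I> X Z"
proof (rule phantomI)
  show "g \<cdot> f \<in> homs S X Z"
    using Comp_in O g phantom_in[OF f] by blast
  fix F w assume F: "finite_object U S F" and w: "w \<in> homs S F X"
  then show "(g \<cdot> f) \<cdot> w = zero_map S F Z"
    using Comp_assoc[of F X Y Z w f g] O g phantom_in[OF f] finite_Ob[OF F]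
      phantom_finite[OF f F w] Comp_zero by metis
qed

lemma phantom_on_projective_zero:
  assumes P: "P \<in> \<P>" and Y: "Y \<in> Ob S" and f: "f \<in> \<I> P Y"
  shows "f = zero_map S P Y"
  using phantom_projective[OF projective_Ob[OF P] Y f P Ident_in[OF projective_Ob[OF P]]]
    Comp_Ident[OF projective_Ob[OF P] Y phantom_in[OF f]] by simp

text \<open>
  It suffices to test phantom maps starting at \<open>P\<close>, since precomposition preserves phantoms.
\<close>

lemma projectiveI:
  assumes P: "P \<in> Ob S" and zero: "\<And>Y f. Y \<in> Ob S \<Longrightarrow> f \<in> \<I> P Y \<Longrightarrow> f = zero_map S P Y"
  shows "P \<in> \<P>"
  unfolding projective_iff using P zero phantom_precomp by blast

text \<open>
  The difference of the two maps is phantom.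
\<close>

lemma equal_on_projective:
  assumes P: "P \<in> \<P>" and Y: "Y \<in> Ob S" and f: "f \<in> homs S P Y" and g: "g \<in> homs S P Y"
    and eq: "\<And>F w. \<lbrakk>finite_object U S F; w \<in> homs S F P\<rbrakk> \<Longrightarrow> f \<cdot> w = g \<cdot> w"
  shows "f = g"
proof -
  note PO = projective_Ob[OF P]
  let ?d = "f \<otimes>\<^bsub>Hom S P Y\<^esub> inv\<^bsub>Hom S P Y\<^esub> g"
  have "?d \<in> \<I> P Y"
  proof (rule phantomI)
    show "?d \<in> homs S P Y"
      by (intro sum_in inv_in PO Y f g)
    fix F w assume F: "finite_object U S F" and w: "w \<in> homs S F P"
    note FO = finite_Ob[OF F]
    have "?d \<cdot> w = (f \<cdot> w) \<otimes>\<^bsub>Hom S F Y\<^esub> inv\<^bsub>Hom S F Y\<^esub> (g \<cdot> w)"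
      using sum_Comp[OF FO PO Y w f inv_in[OF PO Y g]] inv_Comp[OF FO PO Y w g] by simp
    then show "?d \<cdot> w = zero_map S F Y"
      using eq[OF F w] diff_zero_iff[OF FO Y] Comp_in[OF FO PO Y w g] by simp
  qed
  then show ?thesis
    using phantom_on_projective_zero[OF P Y] diff_zero_iff[OF PO Y f g] by blast
qed

text \<open>
  If \<open>C\<close> has no non-zero maps from finite objects, then any map from a projective to \<open>C\<close> agrees with
  the zero map on finite objects, so generation applies.
\<close>

lemma zero_object_by_generation:
  assumes C: "C \<in> Ob S"
    and zero: "\<And>F c. \<lbrakk>finite_object U S F; c \<in> homs S F C\<rbrakk> \<Longrightarrow> c = zero_map S F C"
  shows "is_zero_object S C"
proof (rule ccontr)
  assume "\<not> is_zero_object S C"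
  then obtain P where P: "P \<in> \<P>" and ne: "homs S P C \<noteq> {zero_map S P C}"
    using phantom_class C unfolding generating_phantom_projective_class_def generates_def by blast
  note PO = projective_Ob[OF P]
  have "p = zero_map S P C" if p: "p \<in> homs S P C" for p
    using equal_on_projective[OF P C p zero_in[OF PO C]] zero Comp_in[OF _ PO C] zero_Comp[OF _ PO C]
      zero_in[OF PO C] finite_Ob p by metis
  then show False
    using ne zero_in[OF PO C] by blast
qed

end

text \<open>
  A resolution step: \<open>P\<close> covers \<open>X\<close> as far as finite objects can see, and \<open>W\<close> is the fibre of this
  cover.
\<close>

locale phantom_resolution = phantom_projective_category S U
  for S :: "('o, 'm) tri_cat" (structure) and U :: "'i set set" +
  fixes W P X u e d
  assumes T: "Tri S W P X u e d"
    and P: "P \<in> phantom_projectives U S"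
    and d: "d \<in> phantom_maps U S X (Susp S W)"
begin

lemma Obs [simp]: "W \<in> Ob S" "P \<in> Ob S" "X \<in> Ob S" "Susp S W \<in> Ob S" "Susp S P \<in> Ob S"
  using Tri_maps[OF T] Susp_in by auto

lemma maps [simp]: "u \<in> homs S W P" "e \<in> homs S P X" "d \<in> homs S X (Susp S W)"
  using Tri_maps[OF T] by auto

lemma eu: "e \<cdot> u = zero_map S W X"
  using Tri_comp_zero[OF T] .

lemma lift:
  assumes V: "V \<in> Ob S" and x: "x \<in> homs S V X" and dx: "d \<cdot> x = zero_map S V (Susp S W)"
  shows "\<exists>y \<in> homs S V P. e \<cdot> y = x"
  using Tri_exact[OF rotate_Tri[OF T] V x dx] .

lemma lift_finite:
  "\<lbrakk>finite_object U S F; x \<in> homs S F X\<rbrakk> \<Longrightarrow> \<exists>y \<in> homs S F P. e \<cdot> y = x"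
  using lift phantom_finite[OF d] finite_Ob by blast

lemma lift_projective: "\<lbrakk>Q \<in> \<P>; x \<in> homs S Q X\<rbrakk> \<Longrightarrow> \<exists>y \<in> homs S Q P. e \<cdot> y = x"
  using lift phantom_projective[OF _ _ d] projective_Ob Obs by blast

text \<open>
  The suspension of a map killed by \<open>u\<close> factors through the phantom map \<open>d\<close>.
\<close>

lemma kernel_suspension_phantom:
  assumes V: "V \<in> Ob S" and w: "w \<in> homs S V W" and uw: "u \<cdot> w = zero_map S V P"
  shows "SuspM S w \<in> \<I> (Susp S V) (Susp S W)"
proof -
  obtain r where "r \<in> homs S (Susp S V) X" "d \<cdot> r = SuspM S w"
    using Tri_exact_shifted[OF T V w uw] by blast
  then show ?thesis
    using phantom_precomp[OF _ _ _ d, of "Susp S V" r] V Susp_in Obs by metis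
qed

text \<open>
  For finite \<open>F\<close> and \<open>x : F \<rightarrow> V\<close>, the suspension of \<open>w x\<close> is a phantom map precomposed with a map
  from the finite object \<open>\<Sigma>F\<close>, and \<open>\<Sigma>\<close> is faithful.
\<close>

lemma kernel_phantom:
  assumes V: "V \<in> Ob S" and w: "w \<in> homs S V W" and uw: "u \<cdot> w = zero_map S V P"
  shows "w \<in> \<I> V W"
proof (rule phantomI[OF w])
  fix F x assume F: "finite_object U S F" and x: "x \<in> homs S F V"
  note FO = finite_Ob[OF F]
  have wx: "w \<cdot> x \<in> homs S F W"
    using Comp_in[OF FO V _ x w] by simp
  have "SuspM S (w \<cdot> x) = SuspM S w \<cdot> SuspM S x"
    using SuspM_Comp[OF FO V _ x w] by simp
  also have "\<dots> = zero_map S (Susp S F) (Susp S W)"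
    using phantom_finite[OF kernel_suspension_phantom[OF V w uw] finite_object_Susp[OF F]]
      SuspM_in[OF FO V x] by simp
  finally show "w \<cdot> x = zero_map S F W"
    using SuspM_inj[OF FO _ wx] zero_in[OF FO] SuspM_zero[OF FO] by simp
qed

text \<open>
  On a finite object, send a map to \<open>X\<close> to the composite of \<open>m\<close> with any lift through \<open>e\<close>.  Two lifts
  differ by a map through \<open>u\<close>, on which \<open>m\<close> vanishes because \<open>m u\<close> is phantom.  The Brown property
  realises this natural transformation by a map \<open>s\<close>; the maps \<open>s e\<close> and \<open>m\<close> agree on finite objects,
  hence are equal as \<open>P\<close> is projective.
\<close>

lemma brown_extension:
  assumes brown: "brown_category U S"
    and E: "E \<in> Ob S" and m: "m \<in> homs S P E" and mu: "m \<cdot> u \<in> \<I> W E"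
  shows "\<exists>s \<in> homs S X E. s \<cdot> e = m"
proof -
  define \<tau> where "\<tau> F x = m \<cdot> (SOME y. y \<in> homs S F P \<and> e \<cdot> y = x)" for F x
  have well_defined: "m \<cdot> y = m \<cdot> y'"
    if F: "finite_object U S F" and y: "y \<in> homs S F P" "y' \<in> homs S F P" "e \<cdot> y = e \<cdot> y'" for F y y'
  proof -
    note FO = finite_Ob[OF F]
    let ?z = "y \<otimes>\<^bsub>Hom S F P\<^esub> inv\<^bsub>Hom S F P\<^esub> y'"
    have push: "g \<cdot> ?z = zero_map S F Z \<longleftrightarrow> g \<cdot> y = g \<cdot> y'" if "Z \<in> Ob S" "g \<in> homs S P Z" for Z g
      using Comp_sum[OF FO _ _ y(1) inv_in[OF FO _ y(2)] that(2)] Comp_inv[OF FO _ _ y(2) that(2)]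
        diff_zero_iff[OF FO that(1) Comp_in[OF FO _ _ y(1)] Comp_in[OF FO _ _ y(2)]] that by simp
    have z: "?z \<in> homs S F P"
      by (intro sum_in inv_in FO y Obs)
    have "e \<cdot> ?z = zero_map S F X"
      using push y by simp
    then obtain v where v: "v \<in> homs S F W" "u \<cdot> v = ?z"
      using Tri_exact[OF T FO z] by blast
    then have "m \<cdot> ?z = (m \<cdot> u) \<cdot> v"
      using Comp_assoc[OF FO _ _ E v(1) maps(1) m] by simp
    then have "m \<cdot> ?z = zero_map S F E"
      using phantom_finite[OF mu F v(1)] by simp
    then show ?thesis
      using push E m by simp
  qed
  have \<tau>: "\<tau> F (e \<cdot> y) = m \<cdot> y" if F: "finite_object U S F" and y: "y \<in> homs S F P" for F y
    unfolding \<tau>_def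
    using well_defined[OF F _ y] someI[of "\<lambda>y'. y' \<in> homs S F P \<and> e \<cdot> y' = e \<cdot> y" y] y by blast
  have hom: "\<tau> F \<in> hom (Hom S F X) (Hom S F E)" if F: "finite_object U S F" for F
  proof -
    note FO = finite_Ob[OF F]
    have "\<tau> F x \<in> homs S F E" if x: "x \<in> homs S F X" for x
      using lift_finite[OF F x] \<tau>[OF F] Comp_in[OF FO _ E _ m] by auto
    moreover have "\<tau> F (x \<otimes>\<^bsub>Hom S F X\<^esub> x') = \<tau> F x \<otimes>\<^bsub>Hom S F E\<^esub> \<tau> F x'"
      if x: "x \<in> homs S F X" and x': "x' \<in> homs S F X" for x x'
    proof -
      obtain y y' where y: "y \<in> homs S F P" "e \<cdot> y = x" and y': "y' \<in> homs S F P" "e \<cdot> y' = x'"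
        using lift_finite[OF F] x x' by blast
      have "x \<otimes>\<^bsub>Hom S F X\<^esub> x' = e \<cdot> (y \<otimes>\<^bsub>Hom S F P\<^esub> y')"
        using Comp_sum[OF FO _ _ y(1) y'(1) maps(2)] y y' by simp
      then have "\<tau> F (x \<otimes>\<^bsub>Hom S F X\<^esub> x') = m \<cdot> (y \<otimes>\<^bsub>Hom S F P\<^esub> y')"
        using \<tau>[OF F sum_in[OF FO _ y(1) y'(1)]] by simp
      then show ?thesis
        using Comp_sum[OF FO _ E y(1) y'(1) m] \<tau>[OF F y(1)] \<tau>[OF F y'(1)] y y' by simp
    qed
    ultimately show ?thesis
      unfolding hom_def homs_def by auto
  qed
  have natural: "\<tau> F (x \<cdot> v) = \<tau> G x \<cdot> v"
    if F: "finite_object U S F" and G: "finite_object U S G"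
      and v: "v \<in> homs S F G" and x: "x \<in> homs S G X" for F G v x
  proof -
    note FO = finite_Ob[OF F] and GO = finite_Ob[OF G]
    obtain y where y: "y \<in> homs S G P" "e \<cdot> y = x"
      using lift_finite[OF G x] by blast
    have yv: "y \<cdot> v \<in> homs S F P"
      using Comp_in[OF FO GO _ v y(1)] by simp
    have "x \<cdot> v = e \<cdot> (y \<cdot> v)"
      using Comp_assoc[OF FO GO _ _ v y(1) maps(2)] y by simp
    then have "\<tau> F (x \<cdot> v) = m \<cdot> (y \<cdot> v)"
      using \<tau>[OF F yv] by simp
    also have "\<dots> = (m \<cdot> y) \<cdot> v"
      using Comp_assoc[OF FO GO _ E v y(1) m] by simp
    finally show ?thesis
      using \<tau>[OF G y(1)] y by simp
  qed
  have "finite_nat_trans U S X E \<tau>"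
    unfolding finite_nat_trans_def using hom natural by blast
  then obtain s where s: "s \<in> homs S X E"
    and s\<tau>: "\<And>F x. finite_object U S F \<Longrightarrow> x \<in> homs S F X \<Longrightarrow> \<tau> F x = s \<cdot> x"
    using brown E Obs(3) unfolding brown_category_def by blast
  have se: "s \<cdot> e \<in> homs S P E"
    using Comp_in[OF _ _ E maps(2) s] by simp
  have "s \<cdot> e = m"
  proof (rule equal_on_projective[OF P E se m])
    fix F y assume F: "finite_object U S F" and y: "y \<in> homs S F P"
    note FO = finite_Ob[OF F]
    have "(s \<cdot> e) \<cdot> y = s \<cdot> (e \<cdot> y)"
      using Comp_assoc[OF FO _ _ E y maps(2) s] by simp
    also have "\<dots> = m \<cdot> y"
      using s\<tau>[OF F] \<tau>[OF F y] Comp_in[OF FO _ _ y maps(2)] by simp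
    finally show "(s \<cdot> e) \<cdot> y = m \<cdot> y" .
  qed
  then show ?thesis
    using s by blast
qed

text \<open>
  Both \<open>t\<close> and \<open>\<Sigma>t\<close> are phantom, so \<open>1 - t\<close> and its suspension act as the identity on maps from
  finite objects.  The long exact sequence then shows that the cone of \<open>1 - t\<close> receives only zero
  maps from finite objects, and generation makes that cone a zero object.
\<close>

lemma id_minus_kernel_split_epi:
  assumes t: "t \<in> homs S W W" and ut: "u \<cdot> t = zero_map S W P"
  defines "g \<equiv> Ident S W \<otimes>\<^bsub>Hom S W W\<^esub> inv\<^bsub>Hom S W W\<^esub> t"
  shows "\<exists>r \<in> homs S W W. g \<cdot> r = Ident S W"
proof -
  have g: "g \<in> homs S W W"
    unfolding g_def by (intro sum_in inv_in Ident_in Obs t)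
  obtain C q l where TC: "Tri S W W C g q l"
    using Tri_complete[OF _ _ g] by auto
  have C: "C \<in> Ob S" and q: "q \<in> homs S W C" and l: "l \<in> homs S C (Susp S W)"
    using Tri_maps[OF TC] by auto
  note \<Sigma>t = kernel_suspension_phantom[OF Obs(1) t ut]
  let ?N = "Hom S (Susp S W) (Susp S W)"
  have \<Sigma>g: "SuspM S g = Ident S (Susp S W) \<otimes>\<^bsub>?N\<^esub> inv\<^bsub>?N\<^esub> (SuspM S t)"
  proof -
    interpret s: group_hom "Hom S W W" ?N "SuspM S"
      using SuspM_group_hom by simp
    show ?thesis
      unfolding g_def using t Ident_in[OF Obs(1)] SuspM_Ident[OF Obs(1)] by (simp add: homs_def)
  qed
  have \<Sigma>g_in: "SuspM S g \<in> homs S (Susp S W) (Susp S W)"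
    using SuspM_in g by simp
  \<comment> \<open>\<open>\<Sigma>(1 - t)\<close> kills \<open>l c\<close> and also fixes it, so \<open>l c = 0\<close> and \<open>c\<close> lifts to some \<open>b\<close> in \<open>W\<close>;
    as \<open>1 - t\<close> fixes \<open>b\<close>, the composite \<open>c = q (1 - t) b\<close> vanishes.\<close>
  have "c = zero_map S F C" if F: "finite_object U S F" and c: "c \<in> homs S F C" for F c
  proof -
    note FO = finite_Ob[OF F]
    have lc: "l \<cdot> c \<in> homs S F (Susp S W)"
      using Comp_in[OF FO C _ c l] by simp
    have "(inv\<^bsub>?N\<^esub> (SuspM S g)) \<cdot> l = zero_map S C (Susp S W)"
      using Tri_comp_zero'[OF rotate_Tri[OF TC]] .
    then have "SuspM S g \<cdot> l = zero_map S C (Susp S W)"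
      using inv_Comp[OF C _ _ l \<Sigma>g_in] inv_zero_iff[OF C, of "Susp S W" "SuspM S g \<cdot> l"]
        Comp_in[OF C _ _ l \<Sigma>g_in] by simp
    then have "SuspM S g \<cdot> (l \<cdot> c) = zero_map S F (Susp S W)"
      using Comp_assoc[OF FO C _ _ c l \<Sigma>g_in] zero_Comp[OF FO C _ c] by simp
    moreover have "SuspM S g \<cdot> (l \<cdot> c) = l \<cdot> c"
      using sum_Comp[OF FO _ _ lc Ident_in inv_in[OF _ _ phantom_in[OF \<Sigma>t]]] \<Sigma>g
        inv_Comp[OF FO _ _ lc phantom_in[OF \<Sigma>t]] phantom_finite[OF \<Sigma>t F lc]
        inv_zero[OF FO] sum_zero[OF FO] Ident_Comp[OF FO _ lc] lc by simp
    ultimately have "l \<cdot> c = zero_map S F (Susp S W)"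
      by simp
    then obtain b where b: "b \<in> homs S F W" "q \<cdot> b = c"
      using Tri_exact[OF rotate_Tri[OF TC] FO c] by blast
    have "g \<cdot> b = b"
      unfolding g_def using sum_Comp[OF FO _ _ b(1) Ident_in inv_in[OF _ _ t]] inv_Comp[OF FO _ _ b(1) t]
        phantom_finite[OF kernel_phantom[OF _ t ut] F b(1)]
        inv_zero[OF FO] sum_zero[OF FO] Ident_Comp[OF FO _ b(1)] b by simp
    then have "c = (q \<cdot> g) \<cdot> b"
      using Comp_assoc[OF FO _ _ C b(1) g q] b by simp
    then show ?thesis
      using Tri_comp_zero[OF TC] zero_Comp[OF FO _ C b(1)] by simp
  qed
  then have "is_zero_object S C"
    using zero_object_by_generation[OF C] by blast
  then have "q = zero_map S W C"
    using q zero_in[OF Obs(1) C] Obs(1) unfolding is_zero_object_def by blast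
  then have "q \<cdot> Ident S W = zero_map S W C"
    using zero_Comp[of W W C "Ident S W"] Ident_in C by simp
  then show ?thesis
    using Tri_exact[OF TC _ Ident_in] by simp
qed

text \<open>
  This is where the Brown property makes the fibre projective: it forces \<open>\<phi>\<close> to vanish in the
  homotopy pushout of \<open>u\<close> and \<open>\<phi>\<close>, and generation brings the vanishing back to \<open>\<phi>\<close>.
\<close>

lemma phantom_from_fiber_zero:
  assumes brown: "brown_category U S" and Y: "Y \<in> Ob S" and \<phi>: "\<phi> \<in> \<I> W Y"
  shows "\<phi> = zero_map S W Y"
proof -
  note \<phi>_in = phantom_in[OF \<phi>]
  obtain B i j p q where B: "B \<in> Ob S" and i: "i \<in> homs S P B" and j: "j \<in> homs S Y B"
    and p: "p \<in> homs S B P" and q: "q \<in> homs S B Y"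
    and pi: "p \<cdot> i = Ident S P" and pj: "p \<cdot> j = zero_map S Y P"
    and qi: "q \<cdot> i = zero_map S P Y" and qj: "q \<cdot> j = Ident S Y"
    using biproduct_maps[OF Obs(2) Y] by blast
  have iu: "i \<cdot> u \<in> homs S W B" and j\<phi>: "j \<cdot> \<phi> \<in> homs S W B"
    using Comp_in i j \<phi>_in B Y maps Obs by blast+
  \<comment> \<open>The cone of \<open>v = (u, \<phi>)\<close> is the homotopy pushout; \<open>k i\<close> and \<open>k j\<close> are its structure maps.\<close>
  define v where "v = (i \<cdot> u) \<otimes>\<^bsub>Hom S W B\<^esub> (j \<cdot> \<phi>)"
  have v: "v \<in> homs S W B"
    unfolding v_def by (intro sum_in Obs B iu j\<phi>)
  obtain E k l where TE: "Tri S W B E v k l"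
    using Tri_complete[OF _ B v] by auto
  have E: "E \<in> Ob S" and k: "k \<in> homs S B E"
    using Tri_maps[OF TE] by auto
  have ki: "k \<cdot> i \<in> homs S P E" and kj: "k \<cdot> j \<in> homs S Y E"
    using Comp_in i j k B Y E Obs by blast+
  have kj\<phi>: "k \<cdot> (j \<cdot> \<phi>) \<in> \<I> W E"
    using phantom_postcomp[OF _ Y E \<phi> kj] Comp_assoc[OF _ Y B E \<phi>_in j k] by simp
  have kiu: "k \<cdot> (i \<cdot> u) = (k \<cdot> i) \<cdot> u"
    using Comp_assoc[OF _ _ B E maps(1) i k] by simp
  have "(k \<cdot> (i \<cdot> u)) \<otimes>\<^bsub>Hom S W E\<^esub> (k \<cdot> (j \<cdot> \<phi>)) = zero_map S W E"
    using Comp_sum[OF _ B E iu j\<phi> k] Tri_comp_zero[OF TE] unfolding v_def by simp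
  then have anti: "(k \<cdot> i) \<cdot> u = inv\<^bsub>Hom S W E\<^esub> (k \<cdot> (j \<cdot> \<phi>))"
    unfolding kiu[symmetric] using sum_zero_imp[OF Obs(1) E] Comp_in[OF Obs(1) B E iu k] phantom_in[OF kj\<phi>]
    by blast
  have "(k \<cdot> i) \<cdot> u \<in> \<I> W E"
  proof (rule phantomI)
    show "(k \<cdot> i) \<cdot> u \<in> homs S W E"
      using Comp_in[OF _ _ E maps(1) ki] by simp
    fix F w assume F: "finite_object U S F" and w: "w \<in> homs S F W"
    show "((k \<cdot> i) \<cdot> u) \<cdot> w = zero_map S F E"
      unfolding anti using inv_Comp[OF finite_Ob[OF F] Obs(1) E w phantom_in[OF kj\<phi>]]
        phantom_finite[OF kj\<phi> F w] inv_zero[OF finite_Ob[OF F] E] by simp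
  qed
  then obtain s where s: "s \<in> homs S X E" "s \<cdot> e = k \<cdot> i"
    using brown_extension[OF brown E ki] by blast
  then have "(k \<cdot> i) \<cdot> u = zero_map S W E"
    using Comp_assoc[OF _ _ _ E maps(1) maps(2) s(1)] eu Comp_zero[OF _ _ E s(1)] by simp
  then have "k \<cdot> (j \<cdot> \<phi>) = zero_map S W E"
    using anti inv_zero_iff[OF _ E phantom_in[OF kj\<phi>]] by simp
  \<comment> \<open>Comparing components of \<open>v t = (0, \<phi>)\<close> gives \<open>u t = 0\<close> and \<open>\<phi> t = \<phi>\<close>.\<close>
  then obtain t where t: "t \<in> homs S W W" and vt: "v \<cdot> t = j \<cdot> \<phi>"
    using Tri_exact[OF TE Obs(1) j\<phi>] by blast
  have pj\<phi>: "p \<cdot> (j \<cdot> \<phi>) = zero_map S W P"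
    using Comp_assoc[OF _ Y B _ \<phi>_in j p] pj zero_Comp[OF _ Y _ \<phi>_in] by simp
  have piu: "p \<cdot> (i \<cdot> u) = u"
    using Comp_assoc[OF _ _ B _ maps(1) i p] pi Ident_Comp[OF _ _ maps(1)] by simp
  have "p \<cdot> v = u"
    unfolding v_def using Comp_sum[OF _ B _ iu j\<phi> p] pj\<phi> piu sum_zero[OF _ _ maps(1)] by simp
  then have ut: "u \<cdot> t = zero_map S W P"
    using Comp_assoc[OF _ _ B _ t v p] vt pj\<phi> by simp
  have "q \<cdot> v = \<phi>"
    unfolding v_def using Comp_sum[OF _ B Y iu j\<phi> q] Comp_assoc[OF _ _ B Y maps(1) i q] qi
      Comp_assoc[OF _ Y B Y \<phi>_in j q] qj zero_Comp[OF _ _ Y maps(1)] Ident_Comp[OF _ Y \<phi>_in]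
      zero_sum[OF _ Y \<phi>_in] by simp
  then have \<phi>t: "\<phi> \<cdot> t = \<phi>"
    using Comp_assoc[OF _ _ B Y t v q] vt Comp_assoc[OF _ Y B Y \<phi>_in j q] qj Ident_Comp[OF _ Y \<phi>_in] by simp
  let ?g = "Ident S W \<otimes>\<^bsub>Hom S W W\<^esub> inv\<^bsub>Hom S W W\<^esub> t"
  obtain r where r: "r \<in> homs S W W" "?g \<cdot> r = Ident S W"
    using id_minus_kernel_split_epi[OF t ut] by blast
  have g: "?g \<in> homs S W W"
    by (intro sum_in inv_in Ident_in Obs t)
  have "\<phi> \<cdot> ?g = zero_map S W Y"
    using Comp_sum[OF _ _ Y Ident_in inv_in[OF _ _ t] \<phi>_in] Comp_inv[OF _ _ Y t \<phi>_in] \<phi>t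
      Comp_Ident[OF _ Y \<phi>_in] diff_zero_iff[OF _ Y \<phi>_in \<phi>_in] by simp
  then have "\<phi> \<cdot> (?g \<cdot> r) = zero_map S W Y"
    using Comp_assoc[OF _ _ _ Y r(1) g \<phi>_in] zero_Comp[OF _ _ Y r(1)] by simp
  then show ?thesis
    using r Comp_Ident[OF _ Y \<phi>_in] by simp
qed

lemma fiber_projective: "brown_category U S \<Longrightarrow> W \<in> \<P>"
  by (intro projectiveI phantom_from_fiber_zero Obs)

lemma kernel_on_projective_trivial:
  assumes Q: "Q \<in> \<P>" and w: "w \<in> homs S Q W" and uw: "u \<cdot> w = zero_map S Q P"
  shows "w = zero_map S Q W"
  using phantom_on_projective_zero[OF Q _ kernel_phantom[OF projective_Ob[OF Q] w uw]] by simp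

lemma short_exact_on_projective:
  assumes Q: "Q \<in> \<P>"
  shows "short_exact_sequence (Hom S Q X) (Hom S Q P) (Hom S Q W) (\<lambda>f. e \<cdot> f) (\<lambda>f. u \<cdot> f)"
proof -
  note QO = projective_Ob[OF Q]
  interpret u: group_hom "Hom S Q W" "Hom S Q P" "\<lambda>f. u \<cdot> f"
    using post_comp_hom[OF QO _ _ maps(1)] by simp
  interpret e: group_hom "Hom S Q P" "Hom S Q X" "\<lambda>f. e \<cdot> f"
    using post_comp_hom[OF QO _ _ maps(2)] by simp
  have "e \<cdot> (u \<cdot> w) = zero_map S Q X" if "w \<in> homs S Q W" for w
    using Comp_assoc[OF QO _ _ _ that maps(1) maps(2)] eu zero_Comp[OF QO _ _ that] by simp
  then have ex: "kernel (Hom S Q P) (Hom S Q X) (\<lambda>f. e \<cdot> f) = (\<lambda>f. u \<cdot> f) ` carrier (Hom S Q W)"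
    using Tri_exact[OF T QO] Comp_in[OF QO _ _ _ maps(1)]
    unfolding kernel_def homs_def[symmetric] zero_map_def[symmetric] by auto
  have inj: "inj_on (\<lambda>f. u \<cdot> f) (carrier (Hom S Q W))"
    using u.inj_on_one_iff kernel_on_projective_trivial[OF Q]
    unfolding homs_def[symmetric] zero_map_def[symmetric] by blast
  have surj: "(\<lambda>f. e \<cdot> f) ` carrier (Hom S Q P) = carrier (Hom S Q X)"
    using lift_projective[OF Q] Comp_in[OF QO _ _ _ maps(2)]
    unfolding homs_def[symmetric] by force
  show ?thesis
    unfolding short_exact_sequence_iff using ex inj surj u.group_hom_axioms e.group_hom_axioms
    by (simp add: epi_def mon_def u.homh e.homh e.H.group_axioms)
qed

end


section \<open>Projective dimension in Brown categories\<close>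

theorem theorem5p11:
  fixes S :: "('o, 'm) tri_cat"
    and U :: "'i set set"
    and X :: 'o
  assumes "small_sets U"
    and "triangulated_category S"
    and "has_small_coproducts U S"
    and "generating_phantom_projective_class U S"
    and "brown_category U S"
    and "X \<in> Ob S"
  shows "proj_dim_at_most_one S (phantom_projectives U S) X"
proof -
  interpret phantom_projective_category S U
    using assms(2,4)
    by (simp add: phantom_projective_category_def phantom_projective_category_axioms_def)
  obtain P V e f h where P: "P \<in> \<P>" and f: "f \<in> \<I> X V" and T: "Tri S P X V e f h"
    using assms(4,6)
    unfolding generating_phantom_projective_class_def projective_class_def by blast
  obtain W u b where T': "Tri S W P X u e (b \<cdot>\<^bsub>S\<^esub> f)" and b: "b \<in> homs S V (Susp S W)"
    using desuspend_cone[OF T] by blast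
  have "b \<cdot>\<^bsub>S\<^esub> f \<in> \<I> X (Susp S W)"
    using phantom_postcomp[OF _ _ _ f b] Tri_maps[OF T] Tri_maps[OF T'] Susp_in by blast
  then interpret phantom_resolution S U W P X u e "b \<cdot>\<^bsub>S\<^esub> f"
    using T' P by unfold_locales
  show ?thesis
    unfolding proj_dim_at_most_one_def
    using P fiber_projective[OF assms(5)] maps(1,2) short_exact_on_projective by blast
qed

end
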